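(* Let $F$ be Thompson's group $F$, let $F'=[F,F]$ be its commutator subgroup, and let $f\in F'$ be an arbitrary nonidentity element. Let $C(f)=\{hfh^{-1}: h\in F'\}$ be the conjugacy class of $f$ in $F'$, and let $C(f)^{\pm1}=C(f)\cup\{c^{-1}: c\in C(f)\}$. Then every element of $F'$ is a product of at most six elements of $C(f)^{\pm 1}$. Consequently, $F'$ is a group of finite $C$-width.
   Context: Thompson's group $F$ is realized as $\mathrm{PL}_2([0,1])$: the group, under composition, of all orientation-preserving (i.e. increasing) piecewise linear homeomorphisms of $[0,1]$ onto itself that have finitely many breakpoints, all of them dyadic rationals (elements of $\mathbf{Z}[1/2]$), and all of whose slopes are integer powers of $2$. For a group $G$ and a generating set $S$ of $G$, the length $|g|_S$ of $g\in G$ is the least number of elements of $S\cup S^{-1}$ whose product is $g$; the width of $G$ relative to $S$ is $\mathrm{wid}(G,S)=\sup\{|g|_S: g\in G\}$. A generating set $S$ of $G$ is conjugation-invariant if $gSg^{-1}=S$ for all $g\in G$. The group $G$ is a group of finite $C$-width if $\mathrm{wid}(G,S)<\infty$ for every conjugation-invariant generating set $S$ of $G$. *)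

theory Defs
  imports
    "HOL-Analysis.Analysis"
    "HOL-Algebra.Bij"
    "HOL-Algebra.Generated_Groups"
    "HOL-Library.Extended_Nat"
begin

section \<open>Thompson's group F as PL2([0,1])\<close>

definition dyadic :: "real set" where
  "dyadic = {of_int m / 2 ^ n | (m::int) (n::nat). True}"

text \<open>
  The finite set \<open>B\<close> contains the breakpoints of \<open>f\<close>: on every subinterval of \<open>[0,1]\<close> with no
  point of \<open>B\<close> in its interior, \<open>f\<close> is affine and its slope is an integer power of 2.
\<close>

definition dyadic_piecewise_linear :: "(real \<Rightarrow> real) \<Rightarrow> bool" where
  "dyadic_piecewise_linear f \<longleftrightarrow>
    (\<exists>B. finite B \<and> B \<subseteq> dyadic \<and>
      (\<forall>a b. 0 \<le> a \<and> a < b \<and> b \<le> 1 \<and> {a<..<b} \<inter> B = {} \<longrightarrow>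
        (\<exists>(k::int) c. \<forall>t\<in>{a..b}. f t = 2 powi k * t + c)))"

text \<open>
  As in \<^const>\<open>BijGroup\<close>, a map of \<open>[0,1]\<close> is represented by its extensional function (with
  value \<^term>\<open>undefined\<close> outside \<open>[0,1]\<close>); the product of \<open>g\<close> and \<open>f\<close> is \<open>g\<close> after \<open>f\<close>.
\<close>

definition thompson_F :: "(real \<Rightarrow> real) monoid" where
  "thompson_F = (BijGroup {0..1})
    \<lparr>carrier := {f \<in> extensional {0..1}.
        (\<exists>g. homeomorphism {0..1} {0..1} f g) \<and>
        strict_mono_on {0..1} f \<and>
        dyadic_piecewise_linear f}\<rparr>"

definition commutator_subgroup :: "('a, 'b) monoid_scheme \<Rightarrow> ('a, 'b) monoid_scheme" where
  "commutator_subgroup G = G\<lparr>carrier := derived G (carrier G)\<rparr>"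

abbreviation thompson_F' :: "(real \<Rightarrow> real) monoid" where
  "thompson_F' \<equiv> commutator_subgroup thompson_F"


section \<open>Conjugation, word length and width\<close>

definition conj_class :: "('a, 'b) monoid_scheme \<Rightarrow> 'a \<Rightarrow> 'a set" where
  "conj_class G f = {h \<otimes>\<^bsub>G\<^esub> f \<otimes>\<^bsub>G\<^esub> inv\<^bsub>G\<^esub> h | h. h \<in> carrier G}"

definition with_inverses :: "('a, 'b) monoid_scheme \<Rightarrow> 'a set \<Rightarrow> 'a set" where
  "with_inverses G S = S \<union> {inv\<^bsub>G\<^esub> s | s. s \<in> S}"

definition word_prod :: "('a, 'b) monoid_scheme \<Rightarrow> 'a list \<Rightarrow> 'a" where
  "word_prod G ws = foldr (\<lambda>x y. x \<otimes>\<^bsub>G\<^esub> y) ws \<one>\<^bsub>G\<^esub>"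

text \<open>
  The infimum is taken in \<^typ>\<open>enat\<close>, so the length is \<open>\<infinity>\<close> exactly when no word over
  \<open>S\<close> and its inverses represents \<open>g\<close>; it is attained otherwise.
\<close>

definition word_length :: "('a, 'b) monoid_scheme \<Rightarrow> 'a set \<Rightarrow> 'a \<Rightarrow> enat" where
  "word_length G S g =
    Inf {enat (length ws) | ws. set ws \<subseteq> with_inverses G S \<and> word_prod G ws = g}"

definition width :: "('a, 'b) monoid_scheme \<Rightarrow> 'a set \<Rightarrow> enat" where
  "width G S = (SUP g\<in>carrier G. word_length G S g)"

definition generating_set :: "('a, 'b) monoid_scheme \<Rightarrow> 'a set \<Rightarrow> bool" where
  "generating_set G S \<longleftrightarrow> S \<subseteq> carrier G \<and> generate G S = carrier G"

definition conj_invariant :: "('a, 'b) monoid_scheme \<Rightarrow> 'a set \<Rightarrow> bool" where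
  "conj_invariant G S \<longleftrightarrow>
    (\<forall>g\<in>carrier G. (\<lambda>s. g \<otimes>\<^bsub>G\<^esub> s \<otimes>\<^bsub>G\<^esub> inv\<^bsub>G\<^esub> g) ` S = S)"

definition finite_C_width :: "('a, 'b) monoid_scheme \<Rightarrow> bool" where
  "finite_C_width G \<longleftrightarrow>
    group G \<and> (\<forall>S. generating_set G S \<and> conj_invariant G S \<longrightarrow> width G S < \<infinity>)"

end

theory Submission
  imports Defs
begin

text \<open>
  The proof is a displacement argument. Let \<open>f\<close> be a nonidentity element of the commutator subgroup.
  Replacing \<open>f\<close> by its inverse if necessary, \<open>f\<close> moves some point up, hence moves some dyadic interval
  \<open>J = [p, q]\<close> of length a power of 2 entirely to the right of itself (\<open>interval_moved_off_itself\<close>).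
  The intervals \<open>J\<close>, \<open>f J\<close>, \<open>f (f J)\<close>, \<open>...\<close> are then disjoint, so the conjugates of the group \<open>H\<close> of
  elements supported in \<open>J\<close> by the powers of \<open>f\<close> commute with each other.

  There are two algebraic consequences. A product of any number of commutators of elements of \<open>H\<close> has
  the form \<open>[A, f] [D, E]\<close> (\<open>derived_as_two_commutators\<close>), and a commutator of two elements of \<open>H\<close> is
  a product of four conjugates of \<open>f\<close> and its inverse (\<open>commutator_displaced\<close>). As \<open>[A, f]\<close> is a
  product of two such conjugates, the total is six, provided that \<open>g\<close> can be conjugated to a product
  of commutators in \<open>H\<close>, and \<open>D\<close> and \<open>E\<close> can be conjugated simultaneously into \<open>H\<close>.

  Both follow from one construction. Near an end point the elements of the group are homotheties,
  so commutators are the identity there, and all of the commutator subgroup has compact support in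
  the open interval (\<open>derived_compactly_supported\<close>). The affine map from the unit interval onto \<open>J\<close>
  agrees on any given compact part of the open interval with a compactly supported element \<open>h\<close>
  (\<open>compact_map_agreeing_with_shrink\<close>). Conjugation by \<open>h\<close> therefore brings compactly supported
  elements into \<open>H\<close>. Moreover it acts on \<open>g\<close> like the isomorphism of the whole group onto \<open>H\<close> induced
  by the affine map, which takes products of commutators to products of commutators in \<open>H\<close>
  (\<open>conjugate_eq_transplant\<close>, \<open>transplant_derived\<close>).

  All conjugators so far have compact support; on a compactly supported element each of them acts
  like an element of the commutator subgroup (\<open>conjugate_by_derived\<close>). Finite \<open>C\<close>-width follows, as a
  conjugation-invariant generating set of a nontrivial group contains the conjugacy class of some
  nonidentity element.
\<close>

section \<open>Dyadic rationals\<close>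

lemma dyadic_of_int [simp]: "of_int m \<in> dyadic"
  unfolding dyadic_def by (metis (mono_tags, lifting) div_by_1 mem_Collect_eq power_0)

lemma dyadic_0 [simp]: "0 \<in> dyadic" and dyadic_1 [simp]: "1 \<in> dyadic"
  using dyadic_of_int[of 0] dyadic_of_int[of 1] by simp_all

lemma dyadic_add [intro]:
  assumes "x \<in> dyadic" "y \<in> dyadic" shows "x + y \<in> dyadic"
proof -
  obtain m n m' n' where xy: "x = of_int m / 2 ^ n" "y = of_int m' / 2 ^ n'"
    using assms unfolding dyadic_def by blast
  have "x + y = of_int (m * 2 ^ n' + m' * 2 ^ n) / 2 ^ (n + n')"
    unfolding xy by (simp add: field_simps power_add)
  then show ?thesis unfolding dyadic_def by blast
qed

lemma dyadic_mult [intro]: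
  assumes "x \<in> dyadic" "y \<in> dyadic" shows "x * y \<in> dyadic"
proof -
  obtain m n m' n' where xy: "x = of_int m / 2 ^ n" "y = of_int m' / 2 ^ n'"
    using assms unfolding dyadic_def by blast
  have "x * y = of_int (m * m') / 2 ^ (n + n')"
    unfolding xy by (simp add: field_simps power_add)
  then show ?thesis unfolding dyadic_def by blast
qed

lemma dyadic_diff [intro]:
  assumes "x \<in> dyadic" "y \<in> dyadic" shows "x - y \<in> dyadic"
  using dyadic_add[OF assms(1) dyadic_mult[OF dyadic_of_int[of "-1"] assms(2)]] by simp

lemma dyadic_inverse_power [simp]: "1 / 2 ^ n \<in> dyadic"
  unfolding dyadic_def by (rule CollectI, rule exI[of _ 1]) auto

lemma dyadic_powi [simp]: "2 powi k \<in> dyadic"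
proof (cases "k \<ge> 0")
  case True
  then have "(2::real) powi k = of_int (2 ^ nat k)" by (simp add: power_int_def)
  then show ?thesis by (metis dyadic_of_int)
next
  case False
  then have "(2::real) powi k = 1 / 2 ^ nat (- k)" by (simp add: power_int_def field_simps)
  then show ?thesis by simp
qed

lemma dyadic_powi_mult_iff: "2 powi k * x \<in> dyadic \<longleftrightarrow> x \<in> dyadic"
proof
  assume "2 powi k * x \<in> dyadic"
  then have "2 powi (- k) * (2 powi k * x) \<in> dyadic" by (rule dyadic_mult[OF dyadic_powi])
  moreover have "2 powi (- k) * (2 powi k * x) = x" by (simp add: power_int_minus)
  ultimately show "x \<in> dyadic" by simp
qed (intro dyadic_mult dyadic_powi)

section \<open>Piecewise linear maps of an interval with dyadic breakpoints\<close>

text \<open>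
  The condition \<^const>\<open>dyadic_piecewise_linear\<close> relative to an interval, so that it can be checked
  piece by piece for maps assembled on subintervals.
\<close>

definition pl2_on :: "real \<Rightarrow> real \<Rightarrow> (real \<Rightarrow> real) \<Rightarrow> bool" where
  "pl2_on a b f \<longleftrightarrow>
    (\<exists>B. finite B \<and> B \<subseteq> dyadic \<and>
      (\<forall>u v. a \<le> u \<and> u < v \<and> v \<le> b \<and> {u<..<v} \<inter> B = {} \<longrightarrow>
        (\<exists>(k::int) c. \<forall>t\<in>{u..v}. f t = 2 powi k * t + c)))"

text \<open>
  Induction on the number of breakpoints between \<open>u\<close> and \<open>v\<close>: a relation between points that holds
  across affine pieces and can be composed at a dyadic point holds between any two points. It gives
  strict monotonicity, continuity, the behaviour on dyadic points and the affine germs at the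
  end points.
\<close>

lemma pl2_on_induct:
  assumes "pl2_on a b f" "a \<le> u" "u < v" "v \<le> b"
    and affine: "\<And>u v k c. \<lbrakk>a \<le> u; u < v; v \<le> b; \<forall>t\<in>{u..v}. f t = 2 powi (k::int) * t + c\<rbrakk>
                  \<Longrightarrow> R u v"
    and split: "\<And>u w v. \<lbrakk>a \<le> u; u < w; w < v; v \<le> b; w \<in> dyadic; R u w; R w v\<rbrakk> \<Longrightarrow> R u v"
  shows "R u v"
proof -
  obtain B where B: "finite B" "B \<subseteq> dyadic"
    and aff: "\<And>u v. \<lbrakk>a \<le> u; u < v; v \<le> b; {u<..<v} \<inter> B = {}\<rbrakk>
           \<Longrightarrow> \<exists>(k::int) c. \<forall>t\<in>{u..v}. f t = 2 powi k * t + c"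
    using assms(1) unfolding pl2_on_def by metis
  show ?thesis using assms(2-4)
  proof (induction "card ({u<..<v} \<inter> B)" arbitrary: u v rule: less_induct)
    case less
    show ?case
    proof (cases "{u<..<v} \<inter> B = {}")
      case True
      then show ?thesis using aff affine less.prems by metis
    next
      case False
      then obtain w where w: "u < w" "w < v" "w \<in> B" by auto
      have "card ({u<..<w} \<inter> B) < card ({u<..<v} \<inter> B)"
           "card ({w<..<v} \<inter> B) < card ({u<..<v} \<inter> B)"
        using B(1) w by (auto intro!: psubset_card_mono)
      then have "R u w" "R w v" using less w by auto
      then show ?thesis using split[of u w v] less.prems w B(2) by auto
    qed
  qed
qed

lemma pl2_on_affine:
  assumes "\<forall>t\<in>{a..b}. f t = 2 powi (k::int) * t + c"
  shows "pl2_on a b f"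
  unfolding pl2_on_def using assms by (intro exI[of _ "{}"]) (auto; metis atLeastAtMost_iff order.trans)

lemma pl2_on_cong:
  assumes "pl2_on a b f" "\<And>t. t \<in> {a..b} \<Longrightarrow> f t = g t"
  shows "pl2_on a b g"
proof -
  obtain B where B: "finite B" "B \<subseteq> dyadic"
    and aff: "\<And>u v. \<lbrakk>a \<le> u; u < v; v \<le> b; {u<..<v} \<inter> B = {}\<rbrakk>
           \<Longrightarrow> \<exists>(k::int) c. \<forall>t\<in>{u..v}. f t = 2 powi k * t + c"
    using assms(1) unfolding pl2_on_def by metis
  have "\<exists>(k::int) c. \<forall>t\<in>{u..v}. g t = 2 powi k * t + c"
    if "a \<le> u" "u < v" "v \<le> b" "{u<..<v} \<inter> B = {}" for u v
    using aff[OF that] assms(2) that by (metis atLeastAtMost_iff order.trans)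
  then show ?thesis using B unfolding pl2_on_def by metis
qed

lemma pl2_on_subinterval:
  assumes "pl2_on a b f" "a \<le> a'" "b' \<le> b"
  shows "pl2_on a' b' f"
  using assms unfolding pl2_on_def by (meson order.trans)

lemma pl2_on_join:
  assumes "pl2_on a b f" "pl2_on b c f" "b \<in> dyadic"
  shows "pl2_on a c f"
proof -
  obtain B where B: "finite B" "B \<subseteq> dyadic"
    and aff: "\<And>u v. \<lbrakk>a \<le> u; u < v; v \<le> b; {u<..<v} \<inter> B = {}\<rbrakk>
           \<Longrightarrow> \<exists>(k::int) c. \<forall>t\<in>{u..v}. f t = 2 powi k * t + c"
    using assms(1) unfolding pl2_on_def by metis
  obtain C where C: "finite C" "C \<subseteq> dyadic"
    and aff': "\<And>u v. \<lbrakk>b \<le> u; u < v; v \<le> c; {u<..<v} \<inter> C = {}\<rbrakk>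
           \<Longrightarrow> \<exists>(k::int) c. \<forall>t\<in>{u..v}. f t = 2 powi k * t + c"
    using assms(2) unfolding pl2_on_def by metis
  have "\<exists>(k::int) d. \<forall>t\<in>{u..v}. f t = 2 powi k * t + d"
    if uv: "a \<le> u" "u < v" "v \<le> c" "{u<..<v} \<inter> insert b (B \<union> C) = {}" for u v
  proof -
    have "v \<le> b \<or> b \<le> u" using uv by (auto simp: not_less)
    then show ?thesis using aff[of u v] aff'[of u v] uv by auto
  qed
  then show ?thesis using B C assms(3) unfolding pl2_on_def
    by (intro exI[of _ "insert b (B \<union> C)"]) auto
qed

lemma pl2_on_strict_mono:
  assumes "pl2_on a b f"
  shows "strict_mono_on {a..b} f"
proof (rule strict_mono_onI)
  fix u v assume "u \<in> {a..b}" "v \<in> {a..b}" "u < v"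
  then have "a \<le> u" "u < v" "v \<le> b" by auto
  with assms show "f u < f v"
    by (rule pl2_on_induct) auto
qed

lemma pl2_on_less_iff:
  assumes "pl2_on a b f" "u \<in> {a..b}" "v \<in> {a..b}"
  shows "f u < f v \<longleftrightarrow> u < v"
  using pl2_on_strict_mono[OF assms(1)] assms(2,3)
  by (metis less_irrefl not_less_iff_gr_or_eq strict_mono_onD less_trans)

lemma pl2_on_le_iff:
  assumes "pl2_on a b f" "u \<in> {a..b}" "v \<in> {a..b}"
  shows "f u \<le> f v \<longleftrightarrow> u \<le> v"
  using pl2_on_less_iff[OF assms(1) assms(3,2)] by (meson not_less)

lemma pl2_on_eq_iff:
  assumes "pl2_on a b f" "u \<in> {a..b}" "v \<in> {a..b}"
  shows "f u = f v \<longleftrightarrow> u = v"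
  using pl2_on_less_iff[OF assms(1)] assms(2,3) by (metis less_irrefl linorder_less_linear)

lemma pl2_on_continuous:
  assumes "pl2_on a b f"
  shows "continuous_on {a..b} f"
proof (cases "a < b")
  case True
  show ?thesis
  proof (rule pl2_on_induct[OF assms order.refl True order.refl, where R = "\<lambda>u v. continuous_on {u..v} f"])
    fix u v c and k :: int assume "\<forall>t\<in>{u..v}. f t = 2 powi k * t + c"
    moreover have "continuous_on {u..v} (\<lambda>t. 2 powi k * t + c)" by (intro continuous_intros)
    ultimately show "continuous_on {u..v} f" using continuous_on_cong[of "{u..v}" "{u..v}" f] by auto
  next
    fix u w v :: real
    assume "u < w" "w < v" and *: "continuous_on {u..w} f" "continuous_on {w..v} f"
    then have "{u..v} = {u..w} \<union> {w..v}" by auto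
    then show "continuous_on {u..v} f" using * by (metis continuous_on_closed_Un closed_atLeastAtMost)
  qed
next
  case False
  then show ?thesis by (cases "a = b") auto
qed

lemma pl2_on_image:
  assumes "pl2_on a b f" "a \<le> b"
  shows "f ` {a..b} = {f a..f b}"
proof
  show "f ` {a..b} \<subseteq> {f a..f b}"
    using pl2_on_le_iff[OF assms(1)] assms(2) by auto
  show "{f a..f b} \<subseteq> f ` {a..b}"
    using IVT'[of f a _ b] pl2_on_continuous[OF assms(1)] assms(2) by fastforce
qed

lemma pl2_on_preimage:
  assumes "pl2_on a b f" "a \<le> b" "f a \<le> y" "y \<le> f b"
  obtains t where "t \<in> {a..b}" "f t = y"
  using pl2_on_image[OF assms(1,2)] assms(3,4) by (metis atLeastAtMost_iff imageE)

text \<open>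
  An affine piece with a dyadic base point and a dyadic value there has a dyadic constant term, so it
  neither creates nor destroys dyadic points; this passes from each breakpoint to the next. The
  equivalence keeps breakpoints dyadic under composition (preimages) and inversion (images).
\<close>

lemma pl2_on_dyadic_iff:
  assumes "pl2_on a b f" "a \<in> dyadic" "f a \<in> dyadic" "t \<in> {a..b}"
  shows "f t \<in> dyadic \<longleftrightarrow> t \<in> dyadic"
proof (cases "a < t")
  case True
  then have "a \<le> a" "a < t" "t \<le> b" using assms by auto
  with assms(1) have "a \<in> dyadic \<and> f a \<in> dyadic \<longrightarrow> (f t \<in> dyadic \<longleftrightarrow> t \<in> dyadic)"
  proof (rule pl2_on_induct[where R = "\<lambda>u v. u \<in> dyadic \<and> f u \<in> dyadic \<longrightarrow> (f v \<in> dyadic \<longleftrightarrow> v \<in> dyadic)"])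
    fix u v c and k :: int
    assume uv: "u < v" and affine: "\<forall>t\<in>{u..v}. f t = 2 powi k * t + c"
    show "u \<in> dyadic \<and> f u \<in> dyadic \<longrightarrow> (f v \<in> dyadic \<longleftrightarrow> v \<in> dyadic)"
    proof
      assume d: "u \<in> dyadic \<and> f u \<in> dyadic"
      have "c = f u - 2 powi k * u" using affine uv by auto
      then have c: "c \<in> dyadic" using d by (metis dyadic_diff dyadic_mult dyadic_powi)
      have "f v = 2 powi k * v + c" using affine uv by auto
      then have "f v \<in> dyadic \<longleftrightarrow> 2 powi k * v \<in> dyadic"
        using c by (metis dyadic_add dyadic_diff add_diff_cancel_right')
      then show "f v \<in> dyadic \<longleftrightarrow> v \<in> dyadic" by (simp add: dyadic_powi_mult_iff)
    qed
  qed auto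
  then show ?thesis using assms by blast
qed (use assms in auto)

lemma pl2_on_compose:
  assumes f: "pl2_on a b f" and a: "a \<in> dyadic" "f a \<in> dyadic"
    and g: "pl2_on c d g" and cd: "c \<le> f a" "f b \<le> d"
  shows "pl2_on a b (\<lambda>t. g (f t))"
proof -
  obtain B where B: "finite B" "B \<subseteq> dyadic"
    and aff: "\<And>u v. \<lbrakk>a \<le> u; u < v; v \<le> b; {u<..<v} \<inter> B = {}\<rbrakk>
           \<Longrightarrow> \<exists>(k::int) c. \<forall>t\<in>{u..v}. f t = 2 powi k * t + c"
    using f unfolding pl2_on_def by metis
  obtain C where C: "finite C" "C \<subseteq> dyadic"
    and aff': "\<And>u v. \<lbrakk>c \<le> u; u < v; v \<le> d; {u<..<v} \<inter> C = {}\<rbrakk>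
           \<Longrightarrow> \<exists>(k::int) c. \<forall>t\<in>{u..v}. g t = 2 powi k * t + c"
    using g unfolding pl2_on_def by metis
  \<comment> \<open>The breakpoints of the composition are those of \<open>f\<close> and the preimages of those of \<open>g\<close>.\<close>
  define P where "P = {t\<in>{a..b}. f t \<in> C}"
  have "inj_on f {a..b}" using pl2_on_eq_iff[OF f] by (auto simp: inj_on_def)
  then have "finite P"
    using finite_vimage_IntI[OF C(1), of f "{a..b}"] by (simp add: P_def vimage_def Int_def conj_commute)
  moreover have "P \<subseteq> dyadic" using pl2_on_dyadic_iff[OF f a] C(2) by (auto simp: P_def)
  moreover have "\<exists>(k::int) e. \<forall>t\<in>{u..v}. g (f t) = 2 powi k * t + e"
    if uv: "a \<le> u" "u < v" "v \<le> b" "{u<..<v} \<inter> (B \<union> P) = {}" for u v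
  proof -
    obtain k :: int and e where ke: "\<forall>t\<in>{u..v}. f t = 2 powi k * t + e"
      using aff[of u v] uv by auto
    have range: "c \<le> f u" "f u < f v" "f v \<le> d"
      using pl2_on_le_iff[OF f, of a u] pl2_on_le_iff[OF f, of v b] pl2_on_less_iff[OF f, of u v] uv cd
      by auto
    have "{f u<..<f v} \<inter> C = {}"
    proof (rule ccontr)
      assume "{f u<..<f v} \<inter> C \<noteq> {}"
      then obtain y where y: "f u < y" "y < f v" "y \<in> C" by auto
      have uv': "pl2_on u v f" using f uv pl2_on_subinterval by blast
      then obtain t where t: "t \<in> {u..v}" "f t = y"
        using pl2_on_preimage[of u v f y] y uv(2) by auto
      then have "t \<noteq> u" "t \<noteq> v" using y by auto
      then have "t \<in> {u<..<v} \<inter> P" using t y uv by (auto simp: P_def)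
      then show False using uv by blast
    qed
    then obtain l :: int and e' where le: "\<forall>t\<in>{f u..f v}. g t = 2 powi l * t + e'"
      using aff'[of "f u" "f v"] range by auto
    have "g (f t) = 2 powi (l + k) * t + (2 powi l * e + e')" if "t \<in> {u..v}" for t
    proof -
      have "f t \<in> {f u..f v}"
        using pl2_on_le_iff[OF f, of u t] pl2_on_le_iff[OF f, of t v] that uv by auto
      then show ?thesis using le ke that by (simp add: power_int_add algebra_simps)
    qed
    then show ?thesis by blast
  qed
  ultimately show ?thesis using B unfolding pl2_on_def by (intro exI[of _ "B \<union> P"]) auto
qed

lemma pl2_on_inverse:
  assumes f: "pl2_on a b f" and a: "a \<in> dyadic" "f a \<in> dyadic" and "a \<le> b"
    and g: "\<And>t. t \<in> {a..b} \<Longrightarrow> g (f t) = t"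
  shows "pl2_on (f a) (f b) g"
proof -
  obtain B where B: "finite B" "B \<subseteq> dyadic"
    and aff: "\<And>u v. \<lbrakk>a \<le> u; u < v; v \<le> b; {u<..<v} \<inter> B = {}\<rbrakk>
           \<Longrightarrow> \<exists>(k::int) c. \<forall>t\<in>{u..v}. f t = 2 powi k * t + c"
    using f unfolding pl2_on_def by metis
  define P where "P = f ` (B \<inter> {a..b})"
  have "finite P" using B by (simp add: P_def)
  moreover have "P \<subseteq> dyadic" using pl2_on_dyadic_iff[OF f a] B(2) by (auto simp: P_def)
  moreover have "\<exists>(k::int) e. \<forall>t\<in>{u..v}. g t = 2 powi k * t + e"
    if uv: "f a \<le> u" "u < v" "v \<le> f b" "{u<..<v} \<inter> P = {}" for u v
  proof -
    obtain u' v' where u': "u' \<in> {a..b}" "f u' = u" and v': "v' \<in> {a..b}" "f v' = v"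
      using pl2_on_preimage[OF f \<open>a \<le> b\<close>, of u] pl2_on_preimage[OF f \<open>a \<le> b\<close>, of v] uv
      by (smt (verit))
    have uv': "u' < v'" using pl2_on_less_iff[OF f u'(1) v'(1)] u' v' uv by simp
    have "{u'<..<v'} \<inter> B = {}"
    proof (rule ccontr)
      assume "{u'<..<v'} \<inter> B \<noteq> {}"
      then obtain t where t: "u' < t" "t < v'" "t \<in> B" by auto
      then have "t \<in> {a..b}" using u'(1) v'(1) by auto
      then have "f t \<in> {u<..<v} \<inter> P"
        using t pl2_on_less_iff[OF f u'(1), of t] pl2_on_less_iff[OF f _ v'(1), of t] u'(2) v'(2)
        by (auto simp: P_def)
      then show False using uv(4) by blast
    qed
    then obtain k :: int and c where kc: "\<forall>t\<in>{u'..v'}. f t = 2 powi k * t + c"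
      using aff[of u' v'] u' v' uv' by auto
    have "g y = 2 powi (- k) * y + (- (2 powi (- k)) * c)" if y: "y \<in> {u..v}" for y
    proof -
      have "pl2_on u' v' f" using f u' v' pl2_on_subinterval by auto
      then obtain t where t: "t \<in> {u'..v'}" "f t = y"
        using pl2_on_preimage[of u' v' f y] y u' v' uv' by auto
      then have "g y = t" using g[of t] u' v' by auto
      moreover have "y = 2 powi k * t + c" using kc t by auto
      ultimately show ?thesis by (simp add: power_int_minus field_simps)
    qed
    then show ?thesis by blast
  qed
  ultimately show ?thesis using B unfolding pl2_on_def by (intro exI[of _ P]) auto
qed

definition pl2_map :: "real \<Rightarrow> real \<Rightarrow> real \<Rightarrow> real \<Rightarrow> (real \<Rightarrow> real) \<Rightarrow> bool" where
  "pl2_map a b c d f \<longleftrightarrow> {a, b, c, d} \<subseteq> dyadic \<and> a \<le> b \<and> pl2_on a b f \<and> f a = c \<and> f b = d"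

lemma pl2_map_glue:
  assumes f: "pl2_map a b c d f" and g: "pl2_map b b' d d' g"
  obtains h where "pl2_map a b' c d' h" "\<And>t. t \<in> {a..b} \<Longrightarrow> h t = f t"
    "\<And>t. t \<in> {b..b'} \<Longrightarrow> h t = g t"
proof
  define h where "h t = (if t \<le> b then f t else g t)" for t
  show f': "h t = f t" if "t \<in> {a..b}" for t using that by (simp add: h_def)
  show g': "h t = g t" if "t \<in> {b..b'}" for t
    using that f g by (cases "t = b") (auto simp: h_def pl2_map_def)
  have "pl2_on a b h" "pl2_on b b' h"
    using f g f' g' pl2_on_cong[of a b f h] pl2_on_cong[of b b' g h] unfolding pl2_map_def by auto
  then have "pl2_on a b' h" using f pl2_on_join unfolding pl2_map_def by blast
  moreover have "h a = f a" "h b' = g b'" using f g unfolding pl2_map_def by (auto intro: f' g')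
  ultimately show "pl2_map a b' c d' h" using f g unfolding pl2_map_def by auto
qed

lemma pl2_map_affine:
  assumes "a \<in> dyadic" "b \<in> dyadic" "c \<in> dyadic" "a \<le> b"
  shows "pl2_map a b c (c + 2 powi k * (b - a)) (\<lambda>t. c + 2 powi k * (t - a))"
proof -
  have "pl2_on a b (\<lambda>t. c + 2 powi k * (t - a))"
    by (rule pl2_on_affine[of _ _ _ k "c - 2 powi k * a"]) (simp add: algebra_simps)
  then show ?thesis using assms unfolding pl2_map_def by (auto intro!: dyadic_add dyadic_mult dyadic_diff)
qed

lemma pl2_map_id:
  assumes "a \<in> dyadic" "b \<in> dyadic" "a \<le> b"
  shows "pl2_map a b a b (\<lambda>t. t)"
  using pl2_map_affine[of a b a 0] assms by simp

text \<open>
  Two slopes suffice. If \<open>2^k \<le> (d - c) / (b - a) < 2^(k+1)\<close>, then slope \<open>2^(k+1)\<close> on an initial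
  piece of length \<open>s\<close> followed by slope \<open>2^k\<close> has total rise \<open>2^k * (s + (b - a))\<close>. Equating this
  with \<open>d - c\<close> determines \<open>s\<close>, and \<open>s\<close> is dyadic because the two slopes differ by a power of 2.
\<close>

lemma pl2_map_exists:
  assumes "{a, b, c, d} \<subseteq> dyadic" "a < b" "c < d"
  obtains f where "pl2_map a b c d f"
proof -
  define k where "k = \<lfloor>log 2 ((d - c) / (b - a))\<rfloor>"
  define s where "s = 2 powi (- k) * (d - c) - (b - a)"
  have pos: "(d - c) / (b - a) > 0" using assms by simp
  have "2 powr of_int k \<le> (d - c) / (b - a)" "(d - c) / (b - a) < 2 powr of_int (k + 1)"
    using floor_log_eq_powr_iff[OF pos, of 2 k] by (simp_all add: k_def)
  then have "2 powi k \<le> (d - c) / (b - a)" "(d - c) / (b - a) < 2 powi (k + 1)"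
    by (simp_all only: powr_real_of_int'[of 2, simplified])
  then have le: "2 powi k * (b - a) \<le> d - c" "d - c < 2 powi k * 2 * (b - a)"
    using assms by (auto simp: field_simps power_int_add)
  have "0 \<le> s" "s < b - a"
    using le by (auto simp: s_def power_int_minus field_simps)
  have s: "s \<in> dyadic" unfolding s_def using assms by (auto intro!: dyadic_diff dyadic_mult)
  let ?f = "\<lambda>t. c + 2 powi (k+1) * (t - a)"
  have 1: "pl2_map a (a + s) c (c + 2 powi (k+1) * (a + s - a)) ?f"
    using assms s \<open>0 \<le> s\<close> by (intro pl2_map_affine) auto
  then have "c + 2 powi (k+1) * (a + s - a) \<in> dyadic" unfolding pl2_map_def by blast
  then have 2: "pl2_map (a + s) b (c + 2 powi (k+1) * (a + s - a))
      (c + 2 powi (k+1) * (a + s - a) + 2 powi k * (b - (a + s)))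
      (\<lambda>t. c + 2 powi (k+1) * (a + s - a) + 2 powi k * (t - (a + s)))"
    using assms s \<open>s < b - a\<close> by (intro pl2_map_affine) auto
  have "c + 2 powi (k+1) * (a + s - a) + 2 powi k * (b - (a + s)) = c + 2 powi k * (s + (b - a))"
    by (simp add: power_int_add algebra_simps)
  also have "\<dots> = d" by (simp add: s_def power_int_minus field_simps)
  finally show thesis using 1 2 by (metis pl2_map_glue that)
qed

lemma pl2_map_compose:
  assumes "pl2_map a b c d f" "pl2_map c d c' d' g"
  shows "pl2_map a b c' d' (\<lambda>t. g (f t))"
  using assms pl2_on_compose[of a b f c d g] unfolding pl2_map_def by auto

lemma pl2_map_cong:
  assumes "pl2_map a b c d f" "\<And>t. t \<in> {a..b} \<Longrightarrow> f t = g t"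
  shows "pl2_map a b c d g"
  using assms pl2_on_cong[of a b f g] unfolding pl2_map_def by auto

lemma pl2_map_lower_bound:
  assumes "pl2_map a b c d f" "t \<in> {a..b}"
  shows "c \<le> f t"
  using assms pl2_on_le_iff[of a b f a t] unfolding pl2_map_def by auto

lemma pl2_on_affine_at_left:
  assumes "pl2_on a b f" "a < b"
  obtains e k c where "a < e" "e \<le> b" "\<forall>t\<in>{a..e}. f t = 2 powi (k::int) * t + c"
proof -
  define R where "R u v \<longleftrightarrow> (\<exists>e. u < e \<and> e \<le> v \<and> (\<exists>(k::int) c. \<forall>t\<in>{u..e}. f t = 2 powi k * t + c))"
    for u v
  have "R a b"
    using assms(1) order.refl assms(2) order.refl
  proof (rule pl2_on_induct)
    show "R u v" if "u < v" "\<forall>t\<in>{u..v}. f t = 2 powi (k::int) * t + c" for u v k c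
      unfolding R_def using that by blast
    show "R u v" if "w < v" "R u w" for u v w
      using that unfolding R_def by (meson less_imp_le order.trans)
  qed
  then show thesis unfolding R_def using that by blast
qed

lemma pl2_on_affine_at_right:
  assumes "pl2_on a b f" "a < b"
  obtains e k c where "a \<le> e" "e < b" "\<forall>t\<in>{e..b}. f t = 2 powi (k::int) * t + c"
proof -
  define R where "R u v \<longleftrightarrow> (\<exists>e. u \<le> e \<and> e < v \<and> (\<exists>(k::int) c. \<forall>t\<in>{e..v}. f t = 2 powi k * t + c))"
    for u v
  have "R a b"
    using assms(1) order.refl assms(2) order.refl
  proof (rule pl2_on_induct)
    show "R u v" if "u < v" "\<forall>t\<in>{u..v}. f t = 2 powi (k::int) * t + c" for u v k c
      unfolding R_def using that by blast
    show "R u v" if "u < w" "R w v" for u v w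
      using that unfolding R_def by (meson less_imp_le order.trans)
  qed
  then show thesis unfolding R_def using that by blast
qed


section \<open>Displacement and commutators in an abstract group\<close>

context group
begin

lemma inv_cancel_left:
  assumes "x \<in> carrier G" "y \<in> carrier G"
  shows "inv x \<otimes> (x \<otimes> y) = y" "x \<otimes> (inv x \<otimes> y) = y"
  using assms by (simp_all add: m_assoc [symmetric])

lemmas word_simps = m_assoc inv_mult_group inv_cancel_left

definition conjugate :: "'a \<Rightarrow> 'a \<Rightarrow> 'a" where
  "conjugate k x = k \<otimes> x \<otimes> inv k"

definition commutator :: "'a \<Rightarrow> 'a \<Rightarrow> 'a" where
  "commutator x y = x \<otimes> y \<otimes> inv x \<otimes> inv y"

lemma conjugate_closed [simp, intro]:
  "\<lbrakk>k \<in> carrier G; x \<in> carrier G\<rbrakk> \<Longrightarrow> conjugate k x \<in> carrier G"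
  by (simp add: conjugate_def)

lemma commutator_closed [simp, intro]:
  "\<lbrakk>x \<in> carrier G; y \<in> carrier G\<rbrakk> \<Longrightarrow> commutator x y \<in> carrier G"
  by (simp add: commutator_def)

lemma conjugate_in_subgroup:
  "\<lbrakk>subgroup H G; k \<in> H; x \<in> H\<rbrakk> \<Longrightarrow> conjugate k x \<in> H"
  by (simp add: conjugate_def subgroup.m_closed subgroup.m_inv_closed)

lemma commutator_in_subgroup:
  "\<lbrakk>subgroup H G; x \<in> H; y \<in> H\<rbrakk> \<Longrightarrow> commutator x y \<in> H"
  by (simp add: commutator_def subgroup.m_closed subgroup.m_inv_closed)

lemma conjugate_mult:
  assumes "k \<in> carrier G" "x \<in> carrier G" "y \<in> carrier G"
  shows "conjugate k (x \<otimes> y) = conjugate k x \<otimes> conjugate k y"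
  using assms by (simp add: conjugate_def word_simps)

lemma conjugate_commutator:
  assumes "k \<in> carrier G" "x \<in> carrier G" "y \<in> carrier G"
  shows "conjugate k (commutator x y) = commutator (conjugate k x) (conjugate k y)"
  using assms by (simp add: conjugate_def commutator_def word_simps)

lemma conjugate_conjugate:
  assumes "k \<in> carrier G" "l \<in> carrier G" "x \<in> carrier G"
  shows "conjugate k (conjugate l x) = conjugate (k \<otimes> l) x"
  using assms by (simp add: conjugate_def word_simps)

lemma conjugate_inv:
  assumes "k \<in> carrier G" "x \<in> carrier G"
  shows "inv (conjugate k x) = conjugate k (inv x)"
  using assms by (simp add: conjugate_def word_simps)

lemma conjugate_inv_cancel:
  assumes "k \<in> carrier G" "x \<in> carrier G"
  shows "conjugate (inv k) (conjugate k x) = x"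
  using assms by (simp add: conjugate_def word_simps)

lemma inv_commutator:
  assumes "x \<in> carrier G" "y \<in> carrier G"
  shows "inv (commutator x y) = commutator y x"
  using assms by (simp add: commutator_def word_simps)

lemma commutator_mult_of_commuting:
  assumes sub: "subgroup H G" "subgroup W G"
    and comm: "\<And>h w. \<lbrakk>h \<in> H; w \<in> W\<rbrakk> \<Longrightarrow> h \<otimes> w = w \<otimes> h"
    and mem: "x \<in> W" "y \<in> W" "u \<in> H" "v \<in> H"
  shows "commutator (x \<otimes> u) (y \<otimes> v) = commutator x y \<otimes> commutator u v"
proof -
  have car [simp]: "x \<in> carrier G" "y \<in> carrier G" "u \<in> carrier G" "v \<in> carrier G"
    using sub mem subgroup.mem_carrier by metis+
  have "(x \<otimes> u) \<otimes> (y \<otimes> v) = x \<otimes> (u \<otimes> y) \<otimes> v" by (simp add: m_assoc)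
  also have "\<dots> = (x \<otimes> y) \<otimes> (u \<otimes> v)" using comm[of u y] mem by (simp add: m_assoc)
  finally have xy: "(x \<otimes> u) \<otimes> (y \<otimes> v) = (x \<otimes> y) \<otimes> (u \<otimes> v)" .
  have "(y \<otimes> v) \<otimes> (x \<otimes> u) = y \<otimes> (v \<otimes> x) \<otimes> u" by (simp add: m_assoc)
  also have "\<dots> = (y \<otimes> x) \<otimes> (v \<otimes> u)" using comm[of v x] mem by (simp add: m_assoc)
  finally have yx: "(y \<otimes> v) \<otimes> (x \<otimes> u) = (y \<otimes> x) \<otimes> (v \<otimes> u)" .
  have "commutator (x \<otimes> u) (y \<otimes> v) = ((x \<otimes> u) \<otimes> (y \<otimes> v)) \<otimes> inv ((y \<otimes> v) \<otimes> (x \<otimes> u))"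
    by (simp add: commutator_def word_simps)
  also have "\<dots> = (x \<otimes> y) \<otimes> (commutator u v \<otimes> inv (y \<otimes> x))"
    unfolding xy yx by (simp add: commutator_def word_simps)
  also have "commutator u v \<otimes> inv (y \<otimes> x) = inv (y \<otimes> x) \<otimes> commutator u v"
    by (intro comm commutator_in_subgroup[OF sub(1)] subgroup.m_closed[OF sub(2)]
      subgroup.m_inv_closed[OF sub(2)] mem)
  also have "(x \<otimes> y) \<otimes> (inv (y \<otimes> x) \<otimes> commutator u v) = commutator x y \<otimes> commutator u v"
    by (simp add: commutator_def word_simps)
  finally show ?thesis .
qed

text \<open>
  If \<open>f\<close> conjugates \<open>x\<close> to something commuting with \<open>y\<close>, then \<open>[x, y] = [[x, f], y]\<close>, since
  \<open>[x, f]\<close> is \<open>x\<close> times an element commuting with \<open>y\<close>. The right-hand side, a word in four conjugates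
  of \<open>f\<close> and its inverse, is written out here.
\<close>

lemma commutator_displaced:
  assumes [simp]: "f \<in> carrier G" "x \<in> carrier G" "y \<in> carrier G"
    and comm: "y \<otimes> conjugate f x = conjugate f x \<otimes> y"
  shows "commutator x y = conjugate x f \<otimes> inv f \<otimes> conjugate y f \<otimes> conjugate (y \<otimes> x) (inv f)"
proof -
  have "conjugate x f \<otimes> inv f \<otimes> conjugate y f \<otimes> conjugate (y \<otimes> x) (inv f)
      = x \<otimes> inv (conjugate f x) \<otimes> (y \<otimes> conjugate f x) \<otimes> inv x \<otimes> inv y"
    by (simp add: conjugate_def word_simps)
  also have "\<dots> = commutator x y"
    unfolding comm by (simp add: conjugate_def commutator_def word_simps)
  finally show ?thesis by simp
qed

text \<open>
  Displacement compresses any number of commutators into one commutator with \<open>f\<close> and one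
  correction. Think of \<open>H\<close>, \<open>f H f\<inverse>\<close>, \<open>f\<^sup>2 H f\<^sup>-\<^sup>2\<close>, \<open>...\<close> as commuting copies of \<open>H\<close>, all but the
  first lying in \<open>W\<close>. If \<open>g = g\<^sub>1 ... g\<^sub>m\<close> with \<open>g\<^sub>i = [a\<^sub>i, b\<^sub>i]\<close>, take for \<open>A\<close> the element whose
  \<open>i\<close>-th copy is the tail \<open>g\<^sub>i\<^sub>+\<^sub>1 ... g\<^sub>m\<close>. In \<open>[A, f]\<close> consecutive tails cancel up to one factor:
  it is \<open>g\<close> in copy \<open>0\<close> and the inverse of \<open>g\<^sub>i\<close> in copy \<open>i\<close>. The commutators in different copies
  combine into a single one.
\<close>

lemma derived_as_two_commutators:
  assumes sub: "subgroup H G" "subgroup W G" "subgroup K G" and "H \<subseteq> K" and f: "f \<in> K"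
    and comm: "\<And>h w. \<lbrakk>h \<in> H; w \<in> W\<rbrakk> \<Longrightarrow> h \<otimes> w = w \<otimes> h"
    and fH: "\<And>h. h \<in> H \<Longrightarrow> conjugate f h \<in> W"
    and fW: "\<And>w. w \<in> W \<Longrightarrow> conjugate f w \<in> W"
    and g: "g \<in> derived G H"
  obtains A D E where "A \<in> K" "D \<in> W" "E \<in> W" "g = commutator A f \<otimes> commutator D E"
proof -
  note HK [simp] = subsetD[OF \<open>H \<subseteq> K\<close>]
  note carH [simp] = subgroup.mem_carrier[OF sub(1)]
  note carW [simp] = subgroup.mem_carrier[OF sub(2)]
  note carK [simp] = subgroup.mem_carrier[OF sub(3)]
  have fc [simp]: "f \<in> carrier G" using f by simp
  define P where "P g \<longleftrightarrow> g \<in> H \<and> (\<exists>A\<in>K. \<exists>D\<in>W. \<exists>E\<in>W. commutator A f = g \<otimes> commutator D E)" for g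
  \<comment> \<open>One more commutator in front: the new \<open>A\<close> is the whole product in copy \<open>0\<close>, with the old \<open>A\<close>
      shifted one copy further.\<close>
  have step: "P (commutator a b \<otimes> g)" if P: "P g" and ab: "a \<in> H" "b \<in> H" for a b g
  proof -
    obtain A D E where g: "g \<in> H" and A: "A \<in> K" and D: "D \<in> W" and E: "E \<in> W"
      and eq: "commutator A f = g \<otimes> commutator D E"
      using P unfolding P_def by blast
    define k where "k = commutator a b \<otimes> g"
    have k: "k \<in> H"
      using g ab commutator_in_subgroup[OF sub(1)] subgroup.m_closed[OF sub(1)] by (simp add: k_def)
    have DE: "commutator D E \<in> W" using commutator_in_subgroup[OF sub(2) D E] .
    have "commutator (k \<otimes> conjugate f A) f = k \<otimes> conjugate f (commutator A f \<otimes> inv k)"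
      using A k by (simp add: conjugate_def commutator_def word_simps)
    also have "commutator A f \<otimes> inv k = (g \<otimes> commutator D E) \<otimes> inv g \<otimes> commutator b a"
      using g D E ab by (simp add: eq k_def word_simps inv_commutator)
    also have "\<dots> = commutator D E \<otimes> commutator b a"
      using comm[OF g DE] g D E ab by (simp add: word_simps)
    also have "\<dots> = commutator (D \<otimes> b) (E \<otimes> a)"
      using commutator_mult_of_commuting[OF sub(1,2) comm D E ab(2,1)] by simp
    also have "conjugate f \<dots> = commutator (conjugate f D \<otimes> conjugate f b) (conjugate f E \<otimes> conjugate f a)"
      using D E ab by (simp add: conjugate_commutator conjugate_mult)
    finally have "commutator (k \<otimes> conjugate f A) f = k \<otimes> \<dots>" .
    moreover have "k \<otimes> conjugate f A \<in> K"
      using k A f by (simp add: subgroup.m_closed[OF sub(3)] conjugate_in_subgroup[OF sub(3)])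
    moreover have "conjugate f D \<otimes> conjugate f b \<in> W" "conjugate f E \<otimes> conjugate f a \<in> W"
      using D E ab by (simp_all add: subgroup.m_closed[OF sub(2)] fH fW)
    ultimately show ?thesis using k unfolding P_def k_def by blast
  qed
  have "g \<in> generate G (derived_set G H)" using g by (simp add: derived_def)
  then have "\<forall>x. P x \<longrightarrow> P (g \<otimes> x)"
  proof (induction rule: generate.induct)
    case one
    then show ?case by (auto simp: P_def)
  next
    case (incl h)
    then show ?case using step by (auto simp: commutator_def)
  next
    case (inv h)
    then obtain a b where "a \<in> H" "b \<in> H" "h = commutator a b" by (auto simp: commutator_def)
    then show ?case using step[of _ b a] by (simp add: inv_commutator)
  next
    case (eng g h)
    have "g \<in> carrier G" "h \<in> carrier G"
      using eng(1,2) generate_in_carrier derived_set_in_carrier[of H] subgroup.subset[OF sub(1)] by blast+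
    moreover have "x \<in> carrier G" if "P x" for x using that by (simp add: P_def)
    ultimately show ?case using eng(3,4) by (auto simp: m_assoc)
  qed
  moreover have "P \<one>"
    unfolding P_def using sub
    by (auto intro!: bexI[of _ \<one>] simp: subgroup.one_closed commutator_def)
  moreover have gc: "g \<in> carrier G"
    using g derived_in_carrier subgroup.subset[OF sub(1)] by blast
  ultimately have "P g" by force
  then obtain A D E where A: "A \<in> K" and D: "D \<in> W" and E: "E \<in> W"
    and "commutator A f = g \<otimes> commutator D E"
    unfolding P_def by blast
  then have "commutator A f \<otimes> commutator E D = g \<otimes> (commutator D E \<otimes> inv (commutator D E))"
    using gc by (simp add: m_assoc inv_commutator del: r_inv)
  also have "\<dots> = g" using gc D E by simp
  finally show thesis using that[OF A E D] by simp
qed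

lemma word_prod_closed: "set ws \<subseteq> carrier G \<Longrightarrow> word_prod G ws \<in> carrier G"
  by (induction ws) (auto simp: word_prod_def)

lemma word_prod_append:
  "\<lbrakk>set us \<subseteq> carrier G; set vs \<subseteq> carrier G\<rbrakk>
    \<Longrightarrow> word_prod G (us @ vs) = word_prod G us \<otimes> word_prod G vs"
proof (induction us)
  case (Cons u us)
  then show ?case using word_prod_closed[of us] word_prod_closed[of vs]
    by (simp add: word_prod_def m_assoc)
qed (use word_prod_closed[of vs] in \<open>simp add: word_prod_def\<close>)

lemma word_prod_conjugate:
  assumes "k \<in> carrier G"
  shows "set ws \<subseteq> carrier G \<Longrightarrow> word_prod G (map (conjugate k) ws) = conjugate k (word_prod G ws)"
proof (induction ws)
  case Nil
  then show ?case using assms by (simp add: word_prod_def conjugate_def)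
next
  case (Cons w ws)
  then show ?case using assms word_prod_closed[of ws]
    by (simp add: word_prod_def conjugate_mult)
qed

text \<open>
  Six is two plus four: in \<open>g = [A, f] [D, E]\<close> (up to conjugacy) the first commutator is visibly a
  product of two conjugates. The second need not be displaced by \<open>f\<close>, but a suitable conjugate of
  the pair \<open>D\<close>, \<open>E\<close> lies in \<open>H\<close> and is displaced, which costs four more.
\<close>

lemma product_of_six_conjugates:
  assumes sub: "subgroup H G" "subgroup W G" "subgroup K G" and "H \<subseteq> K" "W \<subseteq> K" and f: "f \<in> K"
    and comm: "\<And>h w. \<lbrakk>h \<in> H; w \<in> W\<rbrakk> \<Longrightarrow> h \<otimes> w = w \<otimes> h"
    and fH: "\<And>h. h \<in> H \<Longrightarrow> conjugate f h \<in> W"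
    and fW: "\<And>w. w \<in> W \<Longrightarrow> conjugate f w \<in> W"
    and push: "\<And>D E. \<lbrakk>D \<in> K; E \<in> K\<rbrakk> \<Longrightarrow> \<exists>k\<in>K. conjugate k D \<in> H \<and> conjugate k E \<in> H"
    and g: "g \<in> carrier G" "l \<in> K" "conjugate l g \<in> derived G H"
  obtains cs where "length cs = 6" "word_prod G cs = g"
    "set cs \<subseteq> {conjugate k c | k c. k \<in> K \<and> c \<in> {f, inv f}}"
proof -
  note carK [simp] = subgroup.mem_carrier[OF sub(3)]
  have fc [simp]: "f \<in> carrier G" using f by simp
  let ?S = "{conjugate k c | k c. k \<in> K \<and> c \<in> {f, inv f}}"
  have S: "conjugate k f \<in> ?S" "conjugate k (inv f) \<in> ?S" if "k \<in> K" for k using that by auto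
  have SG: "?S \<subseteq> carrier G" using f by auto
  have S1: "inv f \<in> ?S"
    using S(2)[of \<one>] subgroup.one_closed[OF sub(3)] by (simp add: conjugate_def)
  have S_conj: "conjugate k ` ?S \<subseteq> ?S" if "k \<in> K" for k
    using that subgroup.m_closed[OF sub(3) that] by (auto simp: conjugate_conjugate) blast+
  obtain A D E where A: "A \<in> K" and DE: "D \<in> W" "E \<in> W"
    and eq: "conjugate l g = commutator A f \<otimes> commutator D E"
    using derived_as_two_commutators[OF sub \<open>H \<subseteq> K\<close> f comm fH fW g(3)] by metis
  then have DK: "D \<in> K" "E \<in> K" using \<open>W \<subseteq> K\<close> by auto
  then obtain k where k: "k \<in> K" "conjugate k D \<in> H" "conjugate k E \<in> H" using push by blast
  define x where "x = conjugate k D"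
  define y where "y = conjugate k E"
  have xy: "x \<in> K" "y \<in> K" "x \<in> H" "y \<in> H" using k \<open>H \<subseteq> K\<close> by (auto simp: x_def y_def)
  define us where "us = [conjugate A f, inv f]"
  define vs where "vs = [conjugate x f, inv f, conjugate y f, conjugate (y \<otimes> x) (inv f)]"
  have us: "set us \<subseteq> ?S" "word_prod G us = commutator A f"
    using S A S1 by (auto simp: us_def word_prod_def conjugate_def commutator_def m_assoc)
  have vs: "set vs \<subseteq> ?S"
    using S(1)[OF xy(1)] S(1)[OF xy(2)] S(2)[OF subgroup.m_closed[OF sub(3) xy(2,1)]] S1
    by (simp add: vs_def)
  have "commutator x y = word_prod G vs"
    using commutator_displaced[OF fc carK[OF xy(1)] carK[OF xy(2)]] comm[OF xy(4) fH[OF xy(3)]] xy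
    by (simp add: vs_def word_prod_def m_assoc)
  then have "commutator D E = conjugate (inv k) (word_prod G vs)"
    using conjugate_inv_cancel[of k "commutator D E"] k DK
    by (simp add: x_def y_def conjugate_commutator)
  also have "\<dots> = word_prod G (map (conjugate (inv k)) vs)"
    using word_prod_conjugate[of "inv k" vs] vs SG k by auto
  finally have "conjugate l g = word_prod G (us @ map (conjugate (inv k)) vs)"
  proof -
    assume *: "commutator D E = word_prod G (map (conjugate (inv k)) vs)"
    have "set us \<subseteq> carrier G" "set (map (conjugate (inv k)) vs) \<subseteq> carrier G"
      using us vs SG S_conj[OF subgroup.m_inv_closed[OF sub(3) k(1)]] by (simp_all only: set_map) blast+
    then show ?thesis using eq * us by (simp only: word_prod_append)
  qed
  then have g': "g = conjugate (inv l) (word_prod G (us @ map (conjugate (inv k)) vs))"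
    using conjugate_inv_cancel[of l g] g by simp
  have 1: "set (us @ map (conjugate (inv k)) vs) \<subseteq> ?S"
    using us vs S_conj[OF subgroup.m_inv_closed[OF sub(3) k(1)]]
    by (simp only: set_map set_append) blast
  show thesis
  proof
    let ?cs = "map (conjugate (inv l)) (us @ map (conjugate (inv k)) vs)"
    show "length ?cs = 6" by (simp add: us_def vs_def)
    show "set ?cs \<subseteq> ?S"
      using 1 S_conj[OF subgroup.m_inv_closed[OF sub(3) g(2)]] by (simp only: set_map) blast
    show "word_prod G ?cs = g"
      using word_prod_conjugate[OF inv_closed[OF carK[OF g(2)]] subset_trans[OF 1 SG]] g' by simp
  qed
qed

end

section \<open>The group structure of Thompson's group\<close>

text \<open>
  Continuity, monotonicity and surjectivity all follow from piecewise linearity with positive slopes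
  once the end points are fixed, so membership reduces to conditions that are easy to check for maps
  glued from pieces.
\<close>

lemma thompson_F_iff:
  "u \<in> carrier thompson_F \<longleftrightarrow> u \<in> extensional {0..1} \<and> pl2_map 0 1 0 1 u"
proof -
  have dpl: "dyadic_piecewise_linear u \<longleftrightarrow> pl2_on 0 1 u"
    by (simp add: dyadic_piecewise_linear_def pl2_on_def)
  show ?thesis
  proof
    assume u: "u \<in> carrier thompson_F"
    then obtain g where g: "homeomorphism {0..1} {0..1} u g"
      and pl: "pl2_on 0 1 u" and ext: "u \<in> extensional {0..1}"
      by (auto simp: thompson_F_def dpl)
    have "u ` {0..1} = {0..1}" using g by (simp add: homeomorphism_def)
    then have "{u 0..u 1} = {0..1}" using pl2_on_image[OF pl] by simp
    then have "u 0 = 0" "u 1 = 1" by (simp_all add: Icc_eq_Icc)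
    then show "u \<in> extensional {0..1} \<and> pl2_map 0 1 0 1 u" using ext pl by (simp add: pl2_map_def)
  next
    assume u: "u \<in> extensional {0..1} \<and> pl2_map 0 1 0 1 u"
    then have pl: "pl2_on 0 1 u" by (simp add: pl2_map_def)
    have "u ` {0..1} = {0..1}" using pl2_on_image[OF pl] u by (simp add: pl2_map_def)
    moreover have "inj_on u {0..1}" using pl2_on_eq_iff[OF pl] by (auto simp: inj_on_def)
    ultimately have "\<exists>g. homeomorphism {0..1} {0..1} u g"
      using homeomorphism_compact pl2_on_continuous[OF pl] by blast
    then show "u \<in> carrier thompson_F"
      using u pl pl2_on_strict_mono[OF pl] by (simp add: thompson_F_def dpl)
  qed
qed

lemma thompson_F_pl2: "u \<in> carrier thompson_F \<Longrightarrow> pl2_on 0 1 u"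
  by (simp add: thompson_F_iff pl2_map_def)

lemma thompson_F_fixes_ends:
  assumes "u \<in> carrier thompson_F"
  shows "u 0 = 0" "u 1 = 1"
  using assms by (simp_all add: thompson_F_iff pl2_map_def)

lemma thompson_F_image: "u \<in> carrier thompson_F \<Longrightarrow> u ` {0..1} = {0..1}"
  using pl2_on_image[of 0 1 u] by (simp add: thompson_F_pl2 thompson_F_fixes_ends)

lemma thompson_F_closed:
  "\<lbrakk>u \<in> carrier thompson_F; t \<in> {0..1}\<rbrakk> \<Longrightarrow> u t \<in> {0..1}"
  using thompson_F_image by blast

lemma thompson_F_subset_Bij: "carrier thompson_F \<subseteq> Bij {0..1}"
proof
  fix u assume u: "u \<in> carrier thompson_F"
  then have "inj_on u {0..1}" using pl2_on_eq_iff[OF thompson_F_pl2] by (auto simp: inj_on_def)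
  then show "u \<in> Bij {0..1}"
    using u thompson_F_image[OF u] by (simp add: Bij_def bij_betw_def thompson_F_iff)
qed

lemma thompson_F_eq: "thompson_F = (BijGroup {0..1})\<lparr>carrier := carrier thompson_F\<rparr>"
  by (simp add: thompson_F_def)

lemma restrict_in_thompson_F:
  "pl2_map 0 1 0 1 u \<Longrightarrow> restrict u {0..1} \<in> carrier thompson_F"
  using pl2_map_cong[of 0 1 0 1 u "restrict u {0..1}"] by (simp add: thompson_F_iff)

lemma subgroup_thompson_F: "subgroup (carrier thompson_F) (BijGroup {0..1})"
proof -
  interpret B: group "BijGroup {0..1::real}" by (rule group_BijGroup)
  show ?thesis
  proof (rule B.subgroupI)
    show "carrier thompson_F \<subseteq> carrier (BijGroup {0..1})"
      using thompson_F_subset_Bij by (simp add: BijGroup_def)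
    show "carrier thompson_F \<noteq> {}"
      using restrict_in_thompson_F[OF pl2_map_id[of 0 1]] by auto
  next
    fix u assume u: "u \<in> carrier thompson_F"
    then have bij: "bij_betw u {0..1} {0..1}" using thompson_F_subset_Bij by (auto simp: Bij_def)
    have inv: "inv\<^bsub>BijGroup {0..1}\<^esub> u = restrict (inv_into {0..1} u) {0..1}"
      using inv_BijGroup u thompson_F_subset_Bij by blast
    have "inv_into {0..1} u (u t) = t" if "t \<in> {0..1}" for t
      using bij that by (simp add: bij_betw_def)
    then have "pl2_on (u 0) (u 1) (inv_into {0..1} u)"
      using pl2_on_inverse[OF thompson_F_pl2[OF u]] thompson_F_fixes_ends[OF u] by simp
    moreover have "inv_into {0..1} u 0 = 0" "inv_into {0..1} u 1 = 1"
      using \<open>\<And>t. t \<in> {0..1} \<Longrightarrow> inv_into {0..1} u (u t) = t\<close>[of 0]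
        \<open>\<And>t. t \<in> {0..1} \<Longrightarrow> inv_into {0..1} u (u t) = t\<close>[of 1] thompson_F_fixes_ends[OF u] by simp_all
    ultimately have "pl2_map 0 1 0 1 (inv_into {0..1} u)"
      using thompson_F_fixes_ends[OF u] by (simp add: pl2_map_def)
    then show "inv\<^bsub>BijGroup {0..1}\<^esub> u \<in> carrier thompson_F"
      unfolding inv by (rule restrict_in_thompson_F)
  next
    fix u v assume u: "u \<in> carrier thompson_F" and v: "v \<in> carrier thompson_F"
    have "u \<otimes>\<^bsub>BijGroup {0..1}\<^esub> v = restrict (\<lambda>t. u (v t)) {0..1}"
      using u v thompson_F_subset_Bij by (auto simp: BijGroup_def compose_def)
    moreover have "pl2_map 0 1 0 1 (\<lambda>t. u (v t))"
      using u v pl2_map_compose unfolding thompson_F_iff by blast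
    ultimately show "u \<otimes>\<^bsub>BijGroup {0..1}\<^esub> v \<in> carrier thompson_F"
      using restrict_in_thompson_F by metis
  qed
qed

interpretation F: group thompson_F
  using group.subgroup_imp_group[OF group_BijGroup subgroup_thompson_F]
  by (simp flip: thompson_F_eq)

lemma mult_apply:
  assumes "u \<in> carrier thompson_F" "v \<in> carrier thompson_F" "t \<in> {0..1}"
  shows "(u \<otimes>\<^bsub>thompson_F\<^esub> v) t = u (v t)"
proof -
  have "u \<in> Bij {0..1}" "v \<in> Bij {0..1}" using assms thompson_F_subset_Bij by auto
  then show ?thesis using assms(3) by (simp add: thompson_F_def BijGroup_def compose_def)
qed

lemma one_apply: "t \<in> {0..1} \<Longrightarrow> \<one>\<^bsub>thompson_F\<^esub> t = t"
  by (simp add: thompson_F_def BijGroup_def)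

lemma inv_apply:
  assumes "u \<in> carrier thompson_F" "t \<in> {0..1}"
  shows "u ((inv\<^bsub>thompson_F\<^esub> u) t) = t" "(inv\<^bsub>thompson_F\<^esub> u) (u t) = t"
  using assms mult_apply[of u "inv\<^bsub>thompson_F\<^esub> u" t] mult_apply[of "inv\<^bsub>thompson_F\<^esub> u" u t]
  by (simp_all add: one_apply)

lemma thompson_F_eqI:
  assumes "u \<in> carrier thompson_F" "v \<in> carrier thompson_F" "\<And>t. t \<in> {0..1} \<Longrightarrow> u t = v t"
  shows "u = v"
  using assms extensionalityI[of u "{0..1}" v] by (simp add: thompson_F_iff)

section \<open>Elements with prescribed support\<close>

text \<open>The rigid stabilizer of \<open>S\<close>.\<close>

definition rigid :: "real set \<Rightarrow> (real \<Rightarrow> real) set" where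
  "rigid S = {u \<in> carrier thompson_F. \<forall>t\<in>{0..1} - S. u t = t}"

lemma rigid_mono: "S \<inter> {0..1} \<subseteq> T \<Longrightarrow> rigid S \<subseteq> rigid T"
  by (auto simp: rigid_def)

lemma rigid_carrier: "u \<in> rigid S \<Longrightarrow> u \<in> carrier thompson_F"
  by (simp add: rigid_def)

lemma rigid_fixes: "\<lbrakk>u \<in> rigid S; t \<in> {0..1}; t \<notin> S\<rbrakk> \<Longrightarrow> u t = t"
  by (simp add: rigid_def)

lemma rigid_preserves:
  assumes "u \<in> rigid S" "t \<in> {0..1}" "t \<in> S"
  shows "u t \<in> S"
proof (rule ccontr)
  assume *: "u t \<notin> S"
  have u: "u \<in> carrier thompson_F" using assms rigid_carrier by blast
  have ut: "u t \<in> {0..1}" using thompson_F_closed u assms(2) by blast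
  have "u (u t) = u t" using rigid_fixes[OF assms(1) ut *] .
  then have "u t = t" using pl2_on_eq_iff[OF thompson_F_pl2[OF u] ut assms(2)] by simp
  then show False using * assms(3) by simp
qed

lemma subgroup_rigid: "subgroup (rigid S) thompson_F"
proof (rule F.subgroupI)
  show "rigid S \<noteq> {}" using one_apply by (auto simp: rigid_def)
next
  fix u assume u: "u \<in> rigid S"
  have "(inv\<^bsub>thompson_F\<^esub> u) t = t" if "t \<in> {0..1} - S" for t
    using inv_apply(2)[of u t] rigid_fixes[OF u, of t] rigid_carrier[OF u] that by auto
  then show "inv\<^bsub>thompson_F\<^esub> u \<in> rigid S" using u by (auto simp: rigid_def)
next
  fix u v assume "u \<in> rigid S" "v \<in> rigid S"
  then show "u \<otimes>\<^bsub>thompson_F\<^esub> v \<in> rigid S" by (auto simp: rigid_def mult_apply)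
qed (auto simp: rigid_def)

lemma rigid_commute:
  assumes u: "u \<in> rigid S" and v: "v \<in> rigid T" and disj: "S \<inter> T = {}"
  shows "u \<otimes>\<^bsub>thompson_F\<^esub> v = v \<otimes>\<^bsub>thompson_F\<^esub> u"
proof (rule thompson_F_eqI)
  note car = rigid_carrier[OF u] rigid_carrier[OF v]
  then show "u \<otimes>\<^bsub>thompson_F\<^esub> v \<in> carrier thompson_F" "v \<otimes>\<^bsub>thompson_F\<^esub> u \<in> carrier thompson_F" by auto
  fix t :: real assume t: "t \<in> {0..1}"
  have "u (v t) = v (u t)"
  proof (cases "t \<in> S")
    case True
    then have "u t \<in> S" "u t \<in> {0..1}" using rigid_preserves[OF u t] thompson_F_closed[OF car(1) t] by auto
    then show ?thesis using rigid_fixes[OF v] t True disj by (metis disjoint_iff)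
  next
    case False
    then have ut: "u t = t" using rigid_fixes[OF u t] by simp
    have "v t \<notin> S"
      using rigid_preserves[OF v t] rigid_fixes[OF v t] disj False by (metis disjoint_iff)
    then show ?thesis using ut rigid_fixes[OF u thompson_F_closed[OF car(2) t]] by simp
  qed
  then show "(u \<otimes>\<^bsub>thompson_F\<^esub> v) t = (v \<otimes>\<^bsub>thompson_F\<^esub> u) t"
    using t car by (simp add: mult_apply)
qed

lemma rigid_conjugate:
  assumes h: "h \<in> carrier thompson_F" and u: "u \<in> rigid S" and sub: "h ` (S \<inter> {0..1}) \<subseteq> T"
  shows "F.conjugate h u \<in> rigid T"
proof -
  note uc = rigid_carrier[OF u]
  have "F.conjugate h u t = t" if t: "t \<in> {0..1}" "t \<notin> T" for t
  proof -
    define s where "s = (inv\<^bsub>thompson_F\<^esub> h) t"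
    have s: "s \<in> {0..1}" "h s = t"
      using thompson_F_closed[of "inv\<^bsub>thompson_F\<^esub> h" t] inv_apply[OF h t(1)] h t by (auto simp: s_def)
    then have "s \<notin> S" using sub t by blast
    then have "u s = s" using rigid_fixes[OF u s(1)] by simp
    then show ?thesis
      using h uc t s by (simp add: F.conjugate_def mult_apply flip: s_def)
  qed
  then show ?thesis using h uc by (auto simp: rigid_def)
qed

text \<open>
  An exhaustion of the open unit interval by closed dyadic intervals. Its discreteness makes the
  elements of compact support an increasing union indexed by natural numbers.
\<close>

definition core :: "nat \<Rightarrow> real set" where
  "core n = {1 / 2 ^ n..1 - 1 / 2 ^ n}"

definition compactly_supported :: "(real \<Rightarrow> real) set" where
  "compactly_supported = (\<Union>n. rigid (core n))"

lemma core_mono: "m \<le> n \<Longrightarrow> core m \<subseteq> core n"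
proof -
  assume "m \<le> n"
  then have "1 / 2 ^ n \<le> (1 / 2 ^ m :: real)" by (simp add: field_simps power_increasing)
  then show ?thesis by (auto simp: core_def)
qed

lemma compactly_supported_level:
  assumes "u \<in> compactly_supported"
  shows "\<exists>n. \<forall>m\<ge>n. u \<in> rigid (core m)"
  using assms rigid_mono[OF order.trans[OF Int_lower1 core_mono]]
  unfolding compactly_supported_def by blast

lemma compactly_supported_common_level:
  assumes "u \<in> compactly_supported" "v \<in> compactly_supported"
  obtains n where "n \<ge> k" "u \<in> rigid (core n)" "v \<in> rigid (core n)"
proof -
  obtain m n where "\<forall>i\<ge>m. u \<in> rigid (core i)" "\<forall>i\<ge>n. v \<in> rigid (core i)"
    using assms compactly_supported_level by metis
  then show thesis using that[of "max k (max m n)"] by auto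
qed

lemma subgroup_compactly_supported: "subgroup compactly_supported thompson_F"
proof (rule F.subgroupI)
  show "compactly_supported \<subseteq> carrier thompson_F"
    by (auto simp: compactly_supported_def rigid_def)
  show "compactly_supported \<noteq> {}"
    using subgroup.one_closed[OF subgroup_rigid] by (auto simp: compactly_supported_def)
next
  fix u assume "u \<in> compactly_supported"
  then show "inv\<^bsub>thompson_F\<^esub> u \<in> compactly_supported"
    using subgroup.m_inv_closed[OF subgroup_rigid] by (auto simp: compactly_supported_def)
next
  fix u v assume "u \<in> compactly_supported" "v \<in> compactly_supported"
  then obtain n where "u \<in> rigid (core n)" "v \<in> rigid (core n)"
    using compactly_supported_common_level by metis
  then show "u \<otimes>\<^bsub>thompson_F\<^esub> v \<in> compactly_supported"
    using subgroup.m_closed[OF subgroup_rigid] by (auto simp: compactly_supported_def)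
qed

lemma dyadic_power_below:
  fixes x :: real assumes "x > 0"
  shows "\<exists>n. \<forall>m\<ge>n. 1 / 2 ^ m < x"
proof -
  obtain n where n: "(1 / 2) ^ n < x" using real_arch_pow_inv[OF assms, of "1/2"] by auto
  have "1 / 2 ^ m < x" if "m \<ge> n" for m
  proof -
    have "(1 / 2 :: real) ^ m \<le> (1 / 2) ^ n" using that by (intro power_decreasing) auto
    then show ?thesis using n by (simp add: power_one_over)
  qed
  then show ?thesis by blast
qed

lemma rigid_subset_compactly_supported:
  assumes "0 < p" "q < 1"
  shows "rigid {p..q} \<subseteq> compactly_supported"
proof -
  obtain n where n: "\<forall>m\<ge>n. 1 / 2 ^ m < min p (1 - q)"
    using dyadic_power_below[of "min p (1 - q)"] assms by auto
  then have "1 / 2 ^ n < min p (1 - q)" by blast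
  then have "{p..q} \<subseteq> core n" by (auto simp: core_def)
  then have "rigid {p..q} \<subseteq> rigid (core n)" by (intro rigid_mono) auto
  then show ?thesis unfolding compactly_supported_def by blast
qed

section \<open>Commutators are compactly supported\<close>

lemma germ_at_end:
  assumes u: "u \<in> carrier thompson_F" and x: "x \<in> {0, 1}"
  obtains e \<alpha> where "e > 0" "\<alpha> > 0"
    "\<And>t. \<lbrakk>t \<in> {0..1}; \<bar>t - x\<bar> \<le> e\<rbrakk> \<Longrightarrow> u t = x + \<alpha> * (t - x)"
proof -
  obtain e k c where e: "0 < e" "e \<le> 1" and near0: "\<forall>t\<in>{0..e}. u t = 2 powi (k::int) * t + c"
    using pl2_on_affine_at_left[OF thompson_F_pl2[OF u]] by auto
  obtain e' k' c' where e': "0 \<le> e'" "e' < 1" and near1: "\<forall>t\<in>{e'..1}. u t = 2 powi (k'::int) * t + c'"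
    using pl2_on_affine_at_right[OF thompson_F_pl2[OF u]] by auto
  show thesis
  proof (cases "x = 0")
    case True
    have "c = 0" using near0 e thompson_F_fixes_ends[OF u] by force
    then show thesis using that[of e "2 powi k"] e near0 True by auto
  next
    case False
    then have "x = 1" using x by simp
    have "c' = 1 - 2 powi k'" using near1 e' thompson_F_fixes_ends[OF u] by force
    then have "u t = 1 + 2 powi k' * (t - 1)" if "t \<in> {0..1}" "\<bar>t - 1\<bar> \<le> 1 - e'" for t
      using near1 that by (auto simp: algebra_simps)
    then show thesis using that[of "1 - e'" "2 powi k'"] e' \<open>x = 1\<close> by auto
  qed
qed

text \<open>
  The germs of \<open>a\<close> and \<open>b\<close> at an end point are homotheties centred there, so they commute. The bound
  \<open>r\<close> is chosen so small that the point \<open>s\<close> with \<open>a (b s) = b (a s) = t\<close>, and its images under \<open>a\<close>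
  and under \<open>b\<close>, stay within the range where both maps are homotheties.
\<close>

lemma commutator_fixes_near_end:
  assumes a: "a \<in> carrier thompson_F" and b: "b \<in> carrier thompson_F" and x: "x \<in> {0, 1}"
  obtains d where "d > 0" "\<And>t. \<lbrakk>t \<in> {0..1}; \<bar>t - x\<bar> \<le> d\<rbrakk> \<Longrightarrow> F.commutator a b t = t"
proof -
  obtain e \<alpha> where e: "e > 0" "\<alpha> > 0" and ga: "\<And>t. \<lbrakk>t \<in> {0..1}; \<bar>t - x\<bar> \<le> e\<rbrakk> \<Longrightarrow> a t = x + \<alpha> * (t - x)"
    using germ_at_end[OF a x] by metis
  obtain e' \<beta> where e': "e' > 0" "\<beta> > 0" and gb: "\<And>t. \<lbrakk>t \<in> {0..1}; \<bar>t - x\<bar> \<le> e'\<rbrakk> \<Longrightarrow> b t = x + \<beta> * (t - x)"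
    using germ_at_end[OF b x] by metis
  define m where "m = min 1 (min e e')"
  have m: "m > 0" "m \<le> 1" "m \<le> e" "m \<le> e'" using e e' by (auto simp: m_def)
  define r where "r = m / (1 + \<alpha> + \<beta>)"
  have "r * (1 + \<alpha> + \<beta>) = m" using e e' by (simp add: r_def)
  moreover have "r > 0" using m e e' by (simp add: r_def)
  then have "0 < \<alpha> * r" "0 < \<beta> * r" using e e' by simp_all
  ultimately have r: "r > 0" "r \<le> m" "\<alpha> * r \<le> m" "\<beta> * r \<le> m"
    using \<open>r > 0\<close> by (simp_all add: algebra_simps)
  show thesis
  proof
    show "\<alpha> * \<beta> * r > 0" using r e e' by simp
    fix t assume t: "t \<in> {0..1}" "\<bar>t - x\<bar> \<le> \<alpha> * \<beta> * r"
    define s where "s = x + (t - x) / (\<alpha> * \<beta>)"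
    have sx: "\<bar>s - x\<bar> \<le> r"
      using t e e' by (simp add: s_def abs_mult field_simps)
    have s01: "s \<in> {0..1}"
    proof (cases "x = 0")
      case True
      then have "s \<ge> 0" using t e e' by (simp add: s_def)
      then show ?thesis using sx r m True by auto
    next
      case False
      then have "x = 1" using x by simp
      then have "s \<le> 1" using t e e' by (simp add: s_def field_simps)
      then show ?thesis using sx r m \<open>x = 1\<close> by auto
    qed
    have as: "a s = x + \<alpha> * (s - x)" using ga[OF s01] sx r m by simp
    have bs: "b s = x + \<beta> * (s - x)" using gb[OF s01] sx r m by simp
    have "\<bar>b s - x\<bar> \<le> \<beta> * r" using bs sx e' by (simp add: abs_mult)
    then have abs: "a (b s) = t"
      using ga[OF thompson_F_closed[OF b s01]] bs r m e e' by (simp add: s_def)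
    have "\<bar>a s - x\<bar> \<le> \<alpha> * r" using as sx e by (simp add: abs_mult)
    then have bas: "b (a s) = t"
      using gb[OF thompson_F_closed[OF a s01]] as r m e e' by (simp add: s_def)
    have "F.commutator a b \<otimes>\<^bsub>thompson_F\<^esub> (b \<otimes>\<^bsub>thompson_F\<^esub> a) = a \<otimes>\<^bsub>thompson_F\<^esub> b"
      using a b by (simp add: F.commutator_def F.word_simps)
    then have "(F.commutator a b \<otimes>\<^bsub>thompson_F\<^esub> (b \<otimes>\<^bsub>thompson_F\<^esub> a)) s = (a \<otimes>\<^bsub>thompson_F\<^esub> b) s" by simp
    then show "F.commutator a b t = t"
      using a b s01 by (simp add: mult_apply abs bas del: atLeastAtMost_iff)
  qed
qed

lemma commutator_compactly_supported:
  assumes a: "a \<in> carrier thompson_F" and b: "b \<in> carrier thompson_F"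
  shows "F.commutator a b \<in> compactly_supported"
proof -
  obtain d where d: "d > 0" "\<And>t. \<lbrakk>t \<in> {0..1}; \<bar>t - 0\<bar> \<le> d\<rbrakk> \<Longrightarrow> F.commutator a b t = t"
    using commutator_fixes_near_end[OF a b, of 0] by blast
  obtain d' where d': "d' > 0" "\<And>t. \<lbrakk>t \<in> {0..1}; \<bar>t - 1\<bar> \<le> d'\<rbrakk> \<Longrightarrow> F.commutator a b t = t"
    using commutator_fixes_near_end[OF a b, of 1] by blast
  have "min d d' > 0" using d(1) d'(1) by simp
  then obtain n where n: "1 / 2 ^ n < min d d'" using dyadic_power_below by blast
  have "F.commutator a b t = t" if "t \<in> {0..1} - core n" for t
  proof (cases "t < 1 / 2 ^ n")
    case True
    then show ?thesis using d(2)[of t] n that by auto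
  next
    case False
    then have "1 - 1 / 2 ^ n < t" using that by (auto simp: core_def)
    then show ?thesis using d'(2)[of t] n that by auto
  qed
  then show ?thesis using a b unfolding compactly_supported_def rigid_def by blast
qed

lemma derived_compactly_supported:
  "derived thompson_F (carrier thompson_F) \<subseteq> compactly_supported"
proof -
  have "derived_set thompson_F (carrier thompson_F) \<subseteq> compactly_supported"
    using commutator_compactly_supported by (auto simp: F.commutator_def)
  then show ?thesis
    unfolding derived_def by (rule F.generate_subgroup_incl[OF _ subgroup_compactly_supported])
qed

section \<open>Copies of Thompson's group on dyadic subintervals\<close>

text \<open>
  The length is required to be a power of 2 so that the affine map from the unit interval onto
  \<open>[p, q]\<close> has an admissible slope; strictness at both ends makes every element supported in
  \<open>[p, q]\<close> compactly supported.
\<close>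

locale dyadic_subinterval =
  fixes p :: real and m :: nat and q :: real
  assumes p_dyadic: "p \<in> dyadic" and p_pos: "0 < p" and q_less: "q < 1"
    and q_def: "q = p + 1 / 2 ^ m"
begin

definition shrink :: "real \<Rightarrow> real" where
  "shrink t = p + t / 2 ^ m"

definition unshrink :: "real \<Rightarrow> real" where
  "unshrink t = (t - p) * 2 ^ m"

definition transplant :: "(real \<Rightarrow> real) \<Rightarrow> real \<Rightarrow> real" where
  "transplant u = restrict (\<lambda>t. if t \<in> {p..q} then shrink (u (unshrink t)) else t) {0..1}"

lemma unshrink_shrink [simp]: "unshrink (shrink t) = t" "shrink (unshrink t) = t"
  by (simp_all add: shrink_def unshrink_def)

lemma shrink_mem_iff [simp]: "shrink t \<in> {p..q} \<longleftrightarrow> t \<in> {0..1}"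
  by (auto simp: shrink_def q_def field_simps)

lemma unshrink_mem: "t \<in> {p..q} \<Longrightarrow> unshrink t \<in> {0..1}"
  using shrink_mem_iff[of "unshrink t"] by simp

lemma pq_subset: "t \<in> {p..q} \<Longrightarrow> t \<in> {0..1}"
  using p_pos q_less by auto

lemma p_less_q: "p < q"
  by (simp add: q_def)

lemma q_dyadic: "q \<in> dyadic"
  unfolding q_def by (intro dyadic_add p_dyadic dyadic_inverse_power)

lemma shrink_pl2: "pl2_map 0 1 p q shrink"
proof -
  have "pl2_map 0 1 p (p + 2 powi (- int m) * (1 - 0)) (\<lambda>t. p + 2 powi (- int m) * (t - 0))"
    using p_dyadic by (intro pl2_map_affine) auto
  moreover have "shrink = (\<lambda>t. p + 2 powi (- int m) * (t - 0))"
    by (auto simp: shrink_def power_int_minus field_simps)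
  ultimately show ?thesis by (simp add: q_def power_int_minus field_simps)
qed

lemma unshrink_pl2: "pl2_map p q 0 1 unshrink"
proof -
  have "pl2_map p q 0 (0 + 2 powi (int m) * (q - p)) (\<lambda>t. 0 + 2 powi (int m) * (t - p))"
    using p_dyadic q_dyadic p_less_q by (intro pl2_map_affine) auto
  moreover have "unshrink = (\<lambda>t. 0 + 2 powi (int m) * (t - p))"
    by (auto simp: unshrink_def)
  ultimately show ?thesis by (simp add: q_def)
qed

lemma transplant_shrink:
  assumes "t \<in> {0..1}"
  shows "transplant u (shrink t) = shrink (u t)"
proof -
  have "shrink t \<in> {p..q}" using assms by (simp only: shrink_mem_iff)
  then show ?thesis using pq_subset[of "shrink t"] by (simp add: transplant_def del: atLeastAtMost_iff)
qed

lemma transplant_outside: "\<lbrakk>t \<in> {0..1}; t \<notin> {p..q}\<rbrakk> \<Longrightarrow> transplant u t = t"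
  by (simp add: transplant_def del: atLeastAtMost_iff)

lemma transplant_rigid:
  assumes u: "u \<in> carrier thompson_F"
  shows "transplant u \<in> rigid {p..q}"
proof -
  define v where "v t = (if t \<in> {p..q} then shrink (u (unshrink t)) else t)" for t
  have "pl2_map p q p q (\<lambda>t. shrink (u (unshrink t)))"
    using u unshrink_pl2 shrink_pl2 pl2_map_compose unfolding thompson_F_iff by blast
  then have mid: "pl2_map p q p q v"
    by (rule pl2_map_cong) (simp add: v_def del: atLeastAtMost_iff)
  then have vpq: "v p = p" "v q = q" by (simp_all add: pl2_map_def)
  have "pl2_map 0 p 0 p (\<lambda>t. t)" "pl2_map q 1 q 1 (\<lambda>t. t)"
    using p_pos q_less p_dyadic q_dyadic by (auto intro!: pl2_map_id)
  moreover have "v t = t" if "t \<in> {0..p} \<union> {q..1}" for t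
    using that vpq by (cases "t = p \<or> t = q") (auto simp: v_def)
  ultimately have "pl2_map 0 p 0 p v" "pl2_map q 1 q 1 v"
    by (auto elim!: pl2_map_cong)
  then have "pl2_on 0 p v" "pl2_on p q v" "pl2_on q 1 v" "v 0 = 0" "v 1 = 1"
    using mid by (simp_all add: pl2_map_def)
  then have "pl2_map 0 1 0 1 v"
    using pl2_on_join[of 0 p v q] pl2_on_join[of 0 q v 1] p_dyadic q_dyadic by (simp add: pl2_map_def)
  then have "transplant u \<in> carrier thompson_F"
    using restrict_in_thompson_F[of v] by (simp add: transplant_def v_def[abs_def])
  then show ?thesis using transplant_outside by (auto simp: rigid_def)
qed

lemma transplant_mult:
  assumes u: "u \<in> carrier thompson_F" and v: "v \<in> carrier thompson_F"
  shows "transplant (u \<otimes>\<^bsub>thompson_F\<^esub> v) = transplant u \<otimes>\<^bsub>thompson_F\<^esub> transplant v"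
proof (rule thompson_F_eqI)
  note uv = rigid_carrier[OF transplant_rigid[OF u]] rigid_carrier[OF transplant_rigid[OF v]]
  show "transplant (u \<otimes>\<^bsub>thompson_F\<^esub> v) \<in> carrier thompson_F"
    using rigid_carrier[OF transplant_rigid] u v by simp
  show "transplant u \<otimes>\<^bsub>thompson_F\<^esub> transplant v \<in> carrier thompson_F" using uv by simp
  fix t :: real assume t: "t \<in> {0..1}"
  show "transplant (u \<otimes>\<^bsub>thompson_F\<^esub> v) t = (transplant u \<otimes>\<^bsub>thompson_F\<^esub> transplant v) t"
  proof (cases "t \<in> {p..q}")
    case True
    define s where "s = unshrink t"
    have s: "s \<in> {0..1}" "t = shrink s" using unshrink_mem[OF True] by (simp_all add: s_def)
    then show ?thesis
      using uv t u v thompson_F_closed[OF v s(1)] by (simp add: mult_apply transplant_shrink del: atLeastAtMost_iff)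
  next
    case False
    then show ?thesis using uv t by (simp add: mult_apply transplant_outside del: atLeastAtMost_iff)
  qed
qed

text \<open>
  Transplanting is what turns a product of commutators of arbitrary elements, possibly moving points
  arbitrarily close to 0 and 1, into a product of commutators of elements supported in \<open>[p, q]\<close>.
\<close>

lemma transplant_derived:
  assumes "g \<in> derived thompson_F (carrier thompson_F)"
  shows "transplant g \<in> derived thompson_F (rigid {p..q})"
proof -
  interpret group_hom thompson_F thompson_F transplant
    by unfold_locales (use transplant_mult rigid_carrier[OF transplant_rigid] in \<open>auto simp: hom_def\<close>)
  have "transplant g \<in> derived thompson_F (transplant ` carrier thompson_F)"
    using assms derived_img[of "carrier thompson_F"] by blast
  also have "\<dots> \<subseteq> derived thompson_F (rigid {p..q})"
    using transplant_rigid by (intro F.mono_derived) auto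
  finally show ?thesis .
qed

text \<open>
  The affine map onto \<open>[p, q]\<close> is not a homeomorphism of the unit interval, but on a compact part it
  can be matched by one of compact support: identity near both ends, and two interpolating pieces.
\<close>

lemma compact_map_agreeing_with_shrink:
  assumes "n \<ge> 2"
  obtains h where "h \<in> compactly_supported" "\<And>t. t \<in> core n \<Longrightarrow> h t = shrink t"
proof -
  define e where "e = (1 / 2 ^ n :: real)"
  have "(1 / 2 :: real) ^ n \<le> (1 / 2) ^ 2" using assms by (intro power_decreasing) auto
  then have e: "0 < e" "e < 1 - e" by (simp_all add: e_def power_one_over power2_eq_square)
  have mono: "p < shrink e" "shrink (1 - e) < q"
    using e by (simp_all add: shrink_def q_def field_simps)
  obtain N where N: "1 / 2 ^ N < min e (min p (1 - q))"
    using dyadic_power_below[of "min e (min p (1 - q))"] e p_pos q_less by auto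
  define d where "d = (1 / 2 ^ N :: real)"
  have d: "0 < d" "d < e" "d < p" "q < 1 - d" using N by (auto simp: d_def)
  have dy: "{0, d, e, 1 - e, 1 - d, 1} \<subseteq> dyadic" by (auto simp: d_def e_def)
  have se: "pl2_map e (1 - e) (shrink e) (shrink (1 - e)) shrink"
    using shrink_pl2 pl2_on_subinterval[of 0 1 shrink e "1 - e"] e dy
      pl2_on_dyadic_iff[of 0 1 shrink] unfolding pl2_map_def by auto
  then have dy': "shrink e \<in> dyadic" "shrink (1 - e) \<in> dyadic" by (auto simp: pl2_map_def)
  have left: "pl2_map 0 d 0 d (\<lambda>t. t)" and right: "pl2_map (1 - d) 1 (1 - d) 1 (\<lambda>t. t)"
    using d e dy by (auto intro!: pl2_map_id)
  obtain l where l: "pl2_map d e d (shrink e) l"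
    using pl2_map_exists[of d e d "shrink e"] dy dy' d mono by auto
  obtain r where r: "pl2_map (1 - e) (1 - d) (shrink (1 - e)) (1 - d) r"
    using pl2_map_exists[of "1 - e" "1 - d" "shrink (1 - e)" "1 - d"] dy dy' d mono by auto
  obtain h1 where h1: "pl2_map 0 e 0 (shrink e) h1" "\<And>t. t \<in> {0..d} \<Longrightarrow> h1 t = t"
    using pl2_map_glue[OF left l] by metis
  obtain h2 where h2: "pl2_map 0 (1 - e) 0 (shrink (1 - e)) h2" "\<And>t. t \<in> {0..e} \<Longrightarrow> h2 t = h1 t"
    "\<And>t. t \<in> {e..1 - e} \<Longrightarrow> h2 t = shrink t"
    using pl2_map_glue[OF h1(1) se] by metis
  obtain h3 where h3: "pl2_map 0 (1 - d) 0 (1 - d) h3" "\<And>t. t \<in> {0..1 - e} \<Longrightarrow> h3 t = h2 t"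
    using pl2_map_glue[OF h2(1) r] by metis
  obtain h where h: "pl2_map 0 1 0 1 h" "\<And>t. t \<in> {0..1 - d} \<Longrightarrow> h t = h3 t"
    "\<And>t. t \<in> {1 - d..1} \<Longrightarrow> h t = t"
    using pl2_map_glue[OF h3(1) right] by metis
  show thesis
  proof
    have "h t = t" if "t \<in> {0..1}" "t \<notin> core N" for t
    proof (cases "t < d")
      case True
      then show ?thesis using that h(2)[of t] h3(2)[of t] h2(2)[of t] h1(2)[of t] d e by simp
    next
      case False
      then show ?thesis using that h(3)[of t] by (auto simp: core_def d_def)
    qed
    then have "restrict h {0..1} \<in> rigid (core N)"
      using restrict_in_thompson_F[OF h(1)] by (auto simp: rigid_def)
    then show "restrict h {0..1} \<in> compactly_supported" by (auto simp: compactly_supported_def)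
    show "restrict h {0..1} t = shrink t" if "t \<in> core n" for t
    proof -
      have t: "t \<in> {e..1 - e}" using that by (simp add: core_def e_def)
      then show ?thesis using h(2)[of t] h3(2)[of t] h2(3)[of t] d e by simp
    qed
  qed
qed

text \<open>
  The conjugate of \<open>g\<close> by \<open>h\<close> depends only on the values of \<open>h\<close> on the support of \<open>g\<close>, and there \<open>h\<close>
  is the affine map that defines the transplant.
\<close>

lemma conjugate_eq_transplant:
  assumes h: "h \<in> carrier thompson_F" and agree: "\<And>t. t \<in> core n \<Longrightarrow> h t = shrink t"
    and g: "g \<in> rigid (core n)"
  shows "F.conjugate h g = transplant g"
proof -
  note gc = rigid_carrier[OF g]
  note tc = rigid_carrier[OF transplant_rigid[OF gc]]
  have "h \<otimes>\<^bsub>thompson_F\<^esub> g = transplant g \<otimes>\<^bsub>thompson_F\<^esub> h"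
  proof (rule thompson_F_eqI)
    fix t :: real assume t: "t \<in> {0..1}"
    have ht: "h t \<in> {0..1}" using thompson_F_closed[OF h t] .
    have "h (g t) = transplant g (h t)"
    proof (cases "t \<in> core n")
      case True
      then show ?thesis using rigid_preserves[OF g t True] agree t by (simp add: transplant_shrink)
    next
      case False
      have "transplant g (h t) = h t"
      proof (cases "h t \<in> {p..q}")
        case True
        define s where "s = unshrink (h t)"
        have s: "s \<in> {0..1}" "h t = shrink s" using unshrink_mem[OF True] by (simp_all add: s_def)
        have "s \<notin> core n"
        proof
          assume "s \<in> core n"
          then have "h s = h t" using agree s by simp
          then have "s = t" using pl2_on_eq_iff[OF thompson_F_pl2[OF h] s(1) t] by simp
          then show False using \<open>s \<in> core n\<close> False by simp
        qed
        then have "g s = s" using rigid_fixes[OF g s(1)] by simp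
        then show ?thesis using s by (simp add: transplant_shrink)
      next
        case False
        then show ?thesis using transplant_outside ht by simp
      qed
      then show ?thesis using rigid_fixes[OF g t False] by simp
    qed
    then show "(h \<otimes>\<^bsub>thompson_F\<^esub> g) t = (transplant g \<otimes>\<^bsub>thompson_F\<^esub> h) t"
      using t h gc tc by (simp add: mult_apply)
  qed (use h gc tc in auto)
  then show ?thesis using h gc tc by (simp add: F.conjugate_def F.word_simps)
qed

lemma conjugate_into_rigid:
  assumes h: "h \<in> carrier thompson_F" and agree: "\<And>t. t \<in> core n \<Longrightarrow> h t = shrink t"
    and g: "g \<in> rigid (core n)"
  shows "F.conjugate h g \<in> rigid {p..q}"
  using conjugate_eq_transplant[OF assms] transplant_rigid[OF rigid_carrier[OF g]] by simp

end

section \<open>Conjugacy in the commutator subgroup\<close>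

lemma displacing_compact_sets:
  assumes "n \<ge> 1"
  obtains s where "s \<in> carrier thompson_F" "s ` core n \<inter> core n = {}"
proof -
  define e where "e = (1 / 2 ^ n :: real)"
  have "(1 / 2 :: real) ^ n \<le> (1 / 2) ^ 1" using assms by (intro power_decreasing) auto
  then have e: "0 < e" "e < 1" by (simp_all add: e_def power_one_over)
  have dy: "{0, e, 1 - e / 2, 1} \<subseteq> dyadic"
    using dyadic_inverse_power[of n] dyadic_inverse_power[of "Suc n"] by (auto simp: e_def mult.commute)
  \<comment> \<open>Aiming at \<open>1 - e / 2\<close> instead of \<open>1 - e\<close> keeps the image off the end point of the core.\<close>
  obtain l where l: "pl2_map 0 e 0 (1 - e / 2) l"
    using pl2_map_exists[of 0 e 0 "1 - e / 2"] dy e by auto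
  obtain r where r: "pl2_map e 1 (1 - e / 2) 1 r"
    using pl2_map_exists[of e 1 "1 - e / 2" 1] dy e by auto
  obtain s where s: "pl2_map 0 1 0 1 s" "\<And>t. t \<in> {e..1} \<Longrightarrow> s t = r t"
    using pl2_map_glue[OF l r] by metis
  show thesis
  proof
    show "restrict s {0..1} \<in> carrier thompson_F" by (rule restrict_in_thompson_F[OF s(1)])
    have "restrict s {0..1} t \<notin> core n" if "t \<in> core n" for t
    proof -
      have t: "t \<in> {e..1}" "t \<in> {0..1}" using that e by (auto simp: core_def e_def[symmetric])
      then have "restrict s {0..1} t \<ge> 1 - e / 2" using s(2) pl2_map_lower_bound[OF r t(1)] by simp
      then show ?thesis using e by (auto simp: core_def e_def[symmetric])
    qed
    then show "restrict s {0..1} ` core n \<inter> core n = {}" by blast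
  qed
qed

text \<open>
  If \<open>s\<close> moves the supports of \<open>f\<close> and \<open>k\<close> off themselves, then \<open>[k, s]\<close> is \<open>k\<close> times an element
  whose support misses that of \<open>f\<close>, so it acts on \<open>f\<close> in the same way as \<open>k\<close>. Hence conjugators may
  be taken in the commutator subgroup, although all that is known of \<open>k\<close> is its compact support.
\<close>

lemma conjugate_by_derived:
  assumes f: "f \<in> compactly_supported" and k: "k \<in> compactly_supported"
  obtains k' where "k' \<in> derived thompson_F (carrier thompson_F)" "F.conjugate k' f = F.conjugate k f"
proof -
  obtain n where n: "n \<ge> 1" "f \<in> rigid (core n)" "k \<in> rigid (core n)"
    using compactly_supported_common_level[OF f k] by metis
  obtain s where s: "s \<in> carrier thompson_F" "s ` core n \<inter> core n = {}"
    using displacing_compact_sets[OF n(1)] by metis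
  note car = rigid_carrier[OF n(2)] rigid_carrier[OF n(3)] s(1)
  define w where "w = F.conjugate s (inv\<^bsub>thompson_F\<^esub> k)"
  have "w \<in> rigid (s ` core n)"
    unfolding w_def using subgroup.m_inv_closed[OF subgroup_rigid n(3)]
    by (rule rigid_conjugate[OF s(1)]) blast
  then have wf: "w \<otimes>\<^bsub>thompson_F\<^esub> f = f \<otimes>\<^bsub>thompson_F\<^esub> w"
    using rigid_commute[OF _ n(2) s(2)] by blast
  have wc: "w \<in> carrier thompson_F" using car by (simp add: w_def)
  have "F.conjugate w f = f" using wf wc car by (simp add: F.conjugate_def F.word_simps)
  moreover have "F.commutator k s = k \<otimes>\<^bsub>thompson_F\<^esub> w"
    using car by (simp add: F.commutator_def F.conjugate_def w_def F.word_simps)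
  ultimately have "F.conjugate (F.commutator k s) f = F.conjugate k f"
    using car wc F.conjugate_conjugate[of k w f] by simp
  moreover have "F.commutator k s \<in> derived thompson_F (carrier thompson_F)"
    unfolding derived_def F.commutator_def using car by (intro generate.incl) blast
  ultimately show thesis using that by blast
qed

section \<open>Products of six conjugates\<close>

text \<open>
  Both end points are chosen strictly between \<open>t\<close> and \<open>f t\<close>; monotonicity of \<open>f\<close> then gives
  \<open>q < f t < f p\<close>.
\<close>

lemma interval_moved_off_itself:
  assumes f: "f \<in> carrier thompson_F" and t: "t \<in> {0..1}" "t < f t"
  obtains p m where "dyadic_subinterval p m (p + 1 / 2 ^ m)" "p + 1 / 2 ^ m < f p"
proof -
  obtain m where m: "1 / 2 ^ m < (f t - t) / 2"
    using dyadic_power_below[of "(f t - t) / 2"] t by auto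
  define p where "p = of_int (\<lfloor>t * 2 ^ m\<rfloor> + 1) / (2 ^ m :: real)"
  have "t * 2 ^ m < of_int (\<lfloor>t * 2 ^ m\<rfloor> + 1)" "of_int (\<lfloor>t * 2 ^ m\<rfloor> + 1) \<le> t * 2 ^ m + 1"
    by linarith+
  then have p: "t < p" "p \<le> t + 1 / 2 ^ m" by (simp_all add: p_def field_simps)
  have "p \<in> dyadic" unfolding p_def dyadic_def by blast
  have "p + d < f t" if "p \<le> t + d" "d < (f t - t) / 2" for d
    using that by (simp add: field_simps)
  then have q: "p + 1 / 2 ^ m < f t" using p(2) m by blast
  have ft: "f t \<le> 1" using thompson_F_closed[OF f t(1)] by simp
  have "1 / 2 ^ m > (0::real)" by simp
  then have p01: "p \<in> {0..1}" using p q ft t by auto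
  have "f t < f p" using pl2_on_less_iff[OF thompson_F_pl2[OF f] t(1) p01] p by simp
  then have "p + 1 / 2 ^ m < f p" using q by simp
  moreover have "dyadic_subinterval p m (p + 1 / 2 ^ m)"
    using \<open>p \<in> dyadic\<close> p q ft t by unfold_locales auto
  ultimately show thesis using that by blast
qed

text \<open>
  The displacement argument applies with \<open>H\<close> the elements supported in \<open>[p, q]\<close> and \<open>W\<close> the compactly
  supported ones living above \<open>q\<close>: since \<open>q < f p\<close> and \<open>f\<close> is increasing, conjugation by \<open>f\<close> takes
  both \<open>H\<close> and \<open>W\<close> into \<open>W\<close>.
\<close>

lemma six_conjugates_of_pushing_up:
  assumes f: "f \<in> compactly_supported" and t: "t \<in> {0..1}" "t < f t"
    and g: "g \<in> derived thompson_F (carrier thompson_F)"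
  obtains cs where "length cs = 6" "word_prod thompson_F cs = g"
    "set cs \<subseteq> {F.conjugate k c | k c. k \<in> compactly_supported \<and> c \<in> {f, inv\<^bsub>thompson_F\<^esub> f}}"
proof -
  have fc: "f \<in> carrier thompson_F" using f subgroup.mem_carrier[OF subgroup_compactly_supported] by blast
  obtain p m where "dyadic_subinterval p m (p + 1 / 2 ^ m)" and up: "p + 1 / 2 ^ m < f p"
    using interval_moved_off_itself[OF fc t] by metis
  define q where "q = p + 1 / 2 ^ m"
  interpret dyadic_subinterval p m q using \<open>dyadic_subinterval p m (p + 1 / 2 ^ m)\<close> by (simp add: q_def)
  have gK: "g \<in> compactly_supported" using g derived_compactly_supported by blast
  define W where "W = rigid {q<..1} \<inter> compactly_supported"
  have pq01: "p \<in> {0..1}" "q \<in> {0..1}" using p_pos q_less p_less_q by auto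
  have above_q: "q < f s" if "s \<in> {0..1}" "p \<le> s" for s
  proof -
    have "f p \<le> f s" using pl2_on_le_iff[OF thompson_F_pl2[OF fc] pq01(1) that(1)] that(2) by simp
    then show ?thesis using up by (simp add: q_def)
  qed
  obtain n where n: "n \<ge> 2" "g \<in> rigid (core n)"
    using compactly_supported_common_level[OF gK gK] by metis
  obtain h where h: "h \<in> compactly_supported" and agree: "\<And>t. t \<in> core n \<Longrightarrow> h t = shrink t"
    using compact_map_agreeing_with_shrink[OF n(1)] by metis
  have hc: "h \<in> carrier thompson_F" using h subgroup.mem_carrier[OF subgroup_compactly_supported] by blast
  show thesis
  proof (rule F.product_of_six_conjugates[of "rigid {p..q}" W compactly_supported f g h])
    show "subgroup (rigid {p..q}) thompson_F" by (rule subgroup_rigid)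
    show "subgroup W thompson_F" unfolding W_def
      by (intro F.subgroups_Inter_pair subgroup_rigid subgroup_compactly_supported)
    show "subgroup compactly_supported thompson_F" by (rule subgroup_compactly_supported)
    show HK: "rigid {p..q} \<subseteq> compactly_supported"
      using rigid_subset_compactly_supported p_pos q_less by blast
    show "W \<subseteq> compactly_supported" by (simp add: W_def)
    show "f \<in> compactly_supported" by (rule f)
    show "h \<otimes>\<^bsub>thompson_F\<^esub> w = w \<otimes>\<^bsub>thompson_F\<^esub> h" if "h \<in> rigid {p..q}" "w \<in> W" for h w
      using that by (intro rigid_commute[of h "{p..q}" w "{q<..1}"]) (auto simp: W_def)
    show "F.conjugate f h \<in> W" if h: "h \<in> rigid {p..q}" for h
    proof -
      have "f ` ({p..q} \<inter> {0..1}) \<subseteq> {q<..1}" using above_q thompson_F_closed[OF fc] by auto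
      then show ?thesis
        using rigid_conjugate[OF fc h] F.conjugate_in_subgroup[OF subgroup_compactly_supported f] HK h
        by (auto simp: W_def)
    qed
    show "F.conjugate f w \<in> W" if w: "w \<in> W" for w
    proof -
      have "f ` ({q<..1} \<inter> {0..1}) \<subseteq> {q<..1}"
        using above_q thompson_F_closed[OF fc] p_less_q by auto
      then show ?thesis
        using rigid_conjugate[OF fc, of w] F.conjugate_in_subgroup[OF subgroup_compactly_supported f] w
        by (auto simp: W_def)
    qed
    show "\<exists>k\<in>compactly_supported. F.conjugate k D \<in> rigid {p..q} \<and> F.conjugate k E \<in> rigid {p..q}"
      if DE: "D \<in> compactly_supported" "E \<in> compactly_supported" for D E
    proof -
      obtain n where n: "n \<ge> 2" "D \<in> rigid (core n)" "E \<in> rigid (core n)"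
        using compactly_supported_common_level[OF DE] by metis
      obtain h where h: "h \<in> compactly_supported" and agree: "\<And>t. t \<in> core n \<Longrightarrow> h t = shrink t"
        using compact_map_agreeing_with_shrink[OF n(1)] by metis
      have "h \<in> carrier thompson_F" using h subgroup.mem_carrier[OF subgroup_compactly_supported] by blast
      then show ?thesis using conjugate_into_rigid[OF _ agree] n h by blast
    qed
    show "h \<in> compactly_supported" by (rule h)
    show "g \<in> carrier thompson_F" using rigid_carrier[OF n(2)] .
    show "F.conjugate h g \<in> derived thompson_F (rigid {p..q})"
      using conjugate_eq_transplant[OF hc agree n(2)] transplant_derived[OF g] by simp
  qed (use that in blast)
qed

text \<open>
  An element that moves some point down has an inverse that moves a point up, and \<open>f\<close> and its inverse
  have the same conjugates up to inversion.
\<close>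

lemma six_conjugates:
  assumes f: "f \<in> compactly_supported" "f \<noteq> \<one>\<^bsub>thompson_F\<^esub>"
    and g: "g \<in> derived thompson_F (carrier thompson_F)"
  obtains cs where "length cs = 6" "word_prod thompson_F cs = g"
    "set cs \<subseteq> {F.conjugate k c | k c. k \<in> compactly_supported \<and> c \<in> {f, inv\<^bsub>thompson_F\<^esub> f}}"
proof -
  have fc: "f \<in> carrier thompson_F" using f subgroup.mem_carrier[OF subgroup_compactly_supported] by blast
  obtain t where t: "t \<in> {0..1}" "f t \<noteq> t"
    using thompson_F_eqI[OF fc F.one_closed] f(2) one_apply by metis
  show thesis
  proof (cases "t < f t")
    case True
    show ?thesis by (rule six_conjugates_of_pushing_up[OF f(1) t(1) True g]) (rule that)
  next
    case False
    have "f t < (inv\<^bsub>thompson_F\<^esub> f) (f t)" using False t inv_apply(2)[OF fc t(1)] by simp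
    moreover have "inv\<^bsub>thompson_F\<^esub> f \<in> compactly_supported"
      using subgroup.m_inv_closed[OF subgroup_compactly_supported f(1)] .
    ultimately obtain cs where cs: "length cs = 6" "word_prod thompson_F cs = g"
      "set cs \<subseteq> {F.conjugate k c | k c. k \<in> compactly_supported \<and>
          c \<in> {inv\<^bsub>thompson_F\<^esub> f, inv\<^bsub>thompson_F\<^esub> (inv\<^bsub>thompson_F\<^esub> f)}}"
      using six_conjugates_of_pushing_up[OF _ thompson_F_closed[OF fc t(1)] _ g] by blast
    have "{inv\<^bsub>thompson_F\<^esub> f, inv\<^bsub>thompson_F\<^esub> (inv\<^bsub>thompson_F\<^esub> f)} = {f, inv\<^bsub>thompson_F\<^esub> f}"
      using fc by auto
    then show ?thesis using that[OF cs(1,2)] cs(3) by simp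
  qed
qed

lemma six_conjugates_in_commutator_subgroup:
  assumes f: "f \<in> carrier thompson_F'" "f \<noteq> \<one>\<^bsub>thompson_F'\<^esub>" and g: "g \<in> carrier thompson_F'"
  obtains cs where "set cs \<subseteq> with_inverses thompson_F' (conj_class thompson_F' f)"
    "length cs = 6" "g = word_prod thompson_F' cs"
proof -
  define D where "D = derived thompson_F (carrier thompson_F)"
  have F': "thompson_F' = thompson_F\<lparr>carrier := D\<rparr>" by (simp add: commutator_subgroup_def D_def)
  have sub: "subgroup D thompson_F" unfolding D_def by (rule F.derived_is_subgroup) simp
  have fD: "f \<in> D" "f \<noteq> \<one>\<^bsub>thompson_F\<^esub>" "g \<in> D" using f g by (simp_all add: F')
  then have fK: "f \<in> compactly_supported" using derived_compactly_supported by (auto simp: D_def)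
  obtain cs where cs: "length cs = 6" "word_prod thompson_F cs = g"
    "set cs \<subseteq> {F.conjugate k c | k c. k \<in> compactly_supported \<and> c \<in> {f, inv\<^bsub>thompson_F\<^esub> f}}"
    by (rule six_conjugates[OF fK fD(2) fD(3)[unfolded D_def]])
  have inv: "inv\<^bsub>thompson_F'\<^esub> x = inv\<^bsub>thompson_F\<^esub> x" if "x \<in> D" for x
    unfolding F' using F.m_inv_consistent[OF sub that] .
  have in_class: "F.conjugate k f \<in> conj_class thompson_F' f \<and> F.conjugate k f \<in> D"
    if k: "k \<in> compactly_supported" for k
  proof -
    obtain k' where k': "k' \<in> D" "F.conjugate k' f = F.conjugate k f"
      using conjugate_by_derived[OF fK k] unfolding D_def by metis
    have "F.conjugate k' f \<in> conj_class thompson_F' f"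
      using k'(1) inv[OF k'(1)] unfolding conj_class_def F.conjugate_def by (force simp: F')
    then show ?thesis using k' F.conjugate_in_subgroup[OF sub k'(1) fD(1)] by simp
  qed
  have "c \<in> with_inverses thompson_F' (conj_class thompson_F' f)" if c: "c \<in> set cs" for c
  proof -
    obtain k where k: "k \<in> compactly_supported"
      and "c = F.conjugate k f \<or> c = F.conjugate k (inv\<^bsub>thompson_F\<^esub> f)"
      using cs(3) c by blast
    then consider "c = F.conjugate k f" | "c = inv\<^bsub>thompson_F'\<^esub> (F.conjugate k f)"
      using inv in_class[OF k] F.conjugate_inv[of k f] fK subgroup.mem_carrier[OF subgroup_compactly_supported]
      by metis
    then show ?thesis using in_class[OF k] by cases (auto simp: with_inverses_def)
  qed
  moreover have "g = word_prod thompson_F' cs" using cs(2) by (simp add: word_prod_def F')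
  ultimately show thesis using that cs(1) by blast
qed

lemma group_thompson_F': "group thompson_F'"
  unfolding commutator_subgroup_def
  by (intro F.subgroup_imp_group F.derived_is_subgroup) simp

lemma word_length_le:
  assumes "set ws \<subseteq> with_inverses G S" "word_prod G ws = g"
  shows "word_length G S g \<le> enat (length ws)"
  unfolding word_length_def using assms by (intro Inf_lower) blast

text \<open>
  A conjugation-invariant generating set containing a nonidentity element \<open>f\<close> contains its whole
  conjugacy class, so six letters suffice. One without such an element generates the trivial group.
\<close>

lemma finite_C_width_thompson_F': "finite_C_width thompson_F'"
  unfolding finite_C_width_def
proof (intro conjI allI impI group_thompson_F')
  interpret F': group thompson_F' by (rule group_thompson_F')
  fix S assume S: "generating_set thompson_F' S \<and> conj_invariant thompson_F' S"
  have "word_length thompson_F' S g \<le> 6" if g: "g \<in> carrier thompson_F'" for g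
  proof (cases "S \<subseteq> {\<one>\<^bsub>thompson_F'\<^esub>}")
    case True
    then have "generate thompson_F' S \<subseteq> {\<one>\<^bsub>thompson_F'\<^esub>}"
      by (intro F'.generate_subgroup_incl F'.triv_subgroup)
    then have "g = \<one>\<^bsub>thompson_F'\<^esub>" using S g by (auto simp: generating_set_def)
    then have "word_prod thompson_F' [] = g" by (simp add: word_prod_def)
    then have "word_length thompson_F' S g \<le> enat 0"
      using word_length_le[of "[]" thompson_F' S g] by simp
    then show ?thesis by (simp add: zero_enat_def[symmetric])
  next
    case False
    then obtain f where f: "f \<in> S" "f \<noteq> \<one>\<^bsub>thompson_F'\<^esub>" by blast
    then have fc: "f \<in> carrier thompson_F'" using S by (auto simp: generating_set_def)
    obtain cs where cs: "set cs \<subseteq> with_inverses thompson_F' (conj_class thompson_F' f)"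
      "length cs = 6" "g = word_prod thompson_F' cs"
      using six_conjugates_in_commutator_subgroup[OF fc f(2) g] by metis
    have "conj_class thompson_F' f \<subseteq> S"
      using S f(1) unfolding conj_invariant_def conj_class_def by blast
    then have "set cs \<subseteq> with_inverses thompson_F' S"
      using cs(1) unfolding with_inverses_def by blast
    then have "word_length thompson_F' S g \<le> enat (length cs)" using cs(3) by (intro word_length_le) auto
    then show ?thesis using cs(2) by (simp add: numeral_eq_enat)
  qed
  then have "width thompson_F' S \<le> 6" unfolding width_def by (intro SUP_least)
  then show "width thompson_F' S < \<infinity>" by (rule order.strict_trans1) simp
qed

theorem proposition2p3:
  shows "(\<forall>f\<in>carrier thompson_F'. f \<noteq> \<one>\<^bsub>thompson_F'\<^esub> \<longrightarrow>
           (\<forall>g\<in>carrier thompson_F'. \<exists>cs. set cs \<subseteq> with_inverses thompson_F' (conj_class thompson_F' f) \<and>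
              length cs \<le> 6 \<and> g = word_prod thompson_F' cs))
         \<and> finite_C_width thompson_F'"
proof (intro conjI ballI impI finite_C_width_thompson_F')
  fix f g assume "f \<in> carrier thompson_F'" "f \<noteq> \<one>\<^bsub>thompson_F'\<^esub>" "g \<in> carrier thompson_F'"
  then show "\<exists>cs. set cs \<subseteq> with_inverses thompson_F' (conj_class thompson_F' f) \<and>
      length cs \<le> 6 \<and> g = word_prod thompson_F' cs"
    by (metis six_conjugates_in_commutator_subgroup order.refl)
qed

end
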